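(* Let $n\ge 3$ and $I:=\{1,2,\dots,n+1\}$. Suppose given real numbers $\theta_{ij}\in[0,\pi]$ for $i,j\in I$ with $\theta_{ij}=\theta_{ji}$ and such that $\theta_{ij}=\pi$ if and only if $i=j$. Then the following two conditions are equivalent: (1) There exists a generalized hyperbolic simplex in $\mathbb{H}^n$ such that, for all $i\neq j$ in $I$, the dihedral angle between its $i$-th facet and its $j$-th facet is $\theta_{ij}$. (2) The real symmetric matrix $G:=(-\cos\theta_{ij})_{i,j\in I}$ of order $n+1$ satisfies both: (a) the signature of $G$ is $(n,1)$, i.e. $G$ has $n$ positive eigenvalues and $1$ negative eigenvalue; (b) $c_{ij}>0$ for all $i,j\in I$ with $i\neq j$, where $c_{ij}:=(-1)^{i+j}\det G_{ij}$ and $G_{ij}$ is the matrix of order $n$ obtained from $G$ by deleting its $i$-th row and $j$-th column.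
   Context: Lorentzian space. $\mathbb{E}^{1,n}$ is $\mathbb{R}^{n+1}$ with the inner product $\langle x,y\rangle=-x_0y_0+x_1y_1+\cdots+x_ny_n$. The affine hyperplane $\mathbb{P}_1^n=\{x : x_0=1\}$, with origin $(1,0,\dots,0)$, contains the open unit ball $\mathbf{B}^n$ centred at that origin, which is the projective (Klein) model of $\mathbb{H}^n$ (radial projection of the upper sheet of $\langle x,x\rangle=-1$); $\partial\mathbf{B}^n$ is the sphere at infinity, $\overline{\mathbf{B}^n}=\mathbf{B}^n\sqcup\partial\mathbf{B}^n$, and $\mathrm{Ext}\,\overline{\mathbf{B}^n}$ is the exterior. For a point $v\in\mathrm{Ext}\,\overline{\mathbf{B}^n}$, let $\tilde v$ be a vector on the line through the origin of $\mathbb{E}^{1,n}$ and $v$ with $\langle\tilde v,\tilde v\rangle=1$; the polar geodesic hyperplane of $v$ is $\Pi_{\tilde v}=\{x\in\mathbf{B}^n:\langle x,\tilde v\rangle=0\}$. Generalized simplex. Let $\triangle$ be an $n$-simplex in $\mathbb{P}_1^n$ containing the origin of $\mathbb{P}_1^n$ (no loss of generality up to isometry of $\mathbb{H}^n$) such that the interior of each of its ridges (i.e. $(n-2)$-dimensional faces) intersects $\overline{\mathbf{B}^n}$. The (polar) truncation of $\triangle$ at a vertex $v\in\mathrm{Ext}\,\overline{\mathbf{B}^n}$ is the operation of omitting the pyramid with apex $v$ and base the $(n-1)$-simplex $\Pi_{\tilde v}\cap\triangle$, and then capping the open end by $\Pi_{\tilde v}\cap\triangle$. The truncated simplex is the polyhedron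 in $\overline{\mathbf{B}^n}$ obtained from $\triangle$ by truncation at all vertices in $\mathrm{Ext}\,\overline{\mathbf{B}^n}$. A generalized (hyperbolic) simplex in $\mathbb{H}^n$ is a polyhedron which is either a simplex in the ordinary sense or such a truncated simplex. The vertices $v_1,\dots,v_{n+1}$ of $\triangle$ are regarded as the vertices of the generalized simplex (vertices created by truncation are not called vertices); a vertex may be finite (in $\mathbf{B}^n$), ideal (in $\partial\mathbf{B}^n$) or ultraideal (in $\mathrm{Ext}\,\overline{\mathbf{B}^n}$). The $i$-th facet is the $(n-1)$-dimensional face opposite to $v_i$ (facets created by truncation are not numbered). Dihedral angles. The dihedral angle $\theta$ between the $i$-th and $j$-th facets ($i\ne j$) is the interior angle, characterized by $\langle u_i,u_j\rangle=-\cos\theta$, where $u_i$ is the outward normal vector of the $i$-th facet with $\langle u_i,u_i\rangle=1$; it is $0$ when the hyperplanes of the two facets meet in $\partial\mathbf{B}^n$ but not in $\mathbf{B}^n$.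
   Formalization: Truncation at an ultraideal vertex also requires the omitted pyramid to be the whole piece cut off and to contain no other vertex of the simplex (else some c_ij can be 0); its base is cut by the whole polar hyperplane, not only its part inside the open ball. *)

theory Defs
  imports
    "HOL-Analysis.Analysis"
    "Jordan_Normal_Form.Char_Poly"
begin

text \<open>
  Points of the Lorentzian space of signature \<open>(1, n)\<close>, with \<open>n = CARD('n)\<close>, are pairs
  \<open>(x\<^sub>0, (x\<^sub>1, \<dots>, x\<^sub>n))\<close>.
\<close>

type_synonym 'n lorentz = "real \<times> (real ^ 'n)"

definition lorentz_inner :: "'n::finite lorentz \<Rightarrow> 'n lorentz \<Rightarrow> real" where
  "lorentz_inner x y = - (fst x * fst y) + inner (snd x) (snd y)"

definition proj_plane :: "'n::finite lorentz set" where
  "proj_plane = {x. fst x = 1}"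

definition proj_origin :: "'n::finite lorentz" where
  "proj_origin = (1, 0)"

definition klein_ball :: "'n::finite lorentz set" where
  "klein_ball = {x \<in> proj_plane. dist x proj_origin < 1}"

definition klein_sphere :: "'n::finite lorentz set" where
  "klein_sphere = {x \<in> proj_plane. dist x proj_origin = 1}"

definition klein_exterior :: "'n::finite lorentz set" where
  "klein_exterior = {x \<in> proj_plane. dist x proj_origin > 1}"

text \<open>
  For \<open>w\<close> in the exterior of the closed ball, \<open>lorentz_inner w w > 0\<close>.
\<close>

definition unit_multiple :: "'n::finite lorentz \<Rightarrow> 'n lorentz" where
  "unit_multiple w = w /\<^sub>R sqrt (lorentz_inner w w)"

text \<open>
  The whole polar hyperplane in the affine chart. The polar geodesic hyperplane is its
  intersection with \<open>klein_ball\<close>. The section of a simplex that serves as the base of a truncation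
  has to be taken with the whole hyperplane: an edge joining two vertices in the exterior may be
  tangent to the ball or (if \<open>n \<ge> 4\<close>) miss it, and then it meets the hyperplane outside the open
  ball.
\<close>

definition polar_hyperplane :: "'n::finite lorentz \<Rightarrow> 'n lorentz set" where
  "polar_hyperplane w = {x \<in> proj_plane. lorentz_inner x (unit_multiple w) = 0}"

definition simplex_indices :: "'n::finite itself \<Rightarrow> nat set" where
  "simplex_indices _ = {1..CARD('n) + 1}"

definition vertex_set :: "(nat \<Rightarrow> 'n::finite lorentz) \<Rightarrow> 'n lorentz set" where
  "vertex_set v = v ` simplex_indices TYPE('n)"

definition simplex_vertices :: "(nat \<Rightarrow> 'n::finite lorentz) \<Rightarrow> bool" where
  "simplex_vertices v \<longleftrightarrow>
     vertex_set v \<subseteq> proj_plane \<and>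
     inj_on v (simplex_indices TYPE('n)) \<and>
     \<not> affine_dependent (vertex_set v)"

definition spanned_simplex :: "(nat \<Rightarrow> 'n::finite lorentz) \<Rightarrow> 'n lorentz set" where
  "spanned_simplex v = convex hull (vertex_set v)"

definition facet_opposite :: "(nat \<Rightarrow> 'n::finite lorentz) \<Rightarrow> nat \<Rightarrow> 'n lorentz set" where
  "facet_opposite v i = convex hull (v ` (simplex_indices TYPE('n) - {i}))"

definition ridge_opposite :: "(nat \<Rightarrow> 'n::finite lorentz) \<Rightarrow> nat \<Rightarrow> nat \<Rightarrow> 'n lorentz set" where
  "ridge_opposite v i j = convex hull (v ` (simplex_indices TYPE('n) - {i, j}))"

definition ridges_meet_closed_ball :: "(nat \<Rightarrow> 'n::finite lorentz) \<Rightarrow> bool" where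
  "ridges_meet_closed_ball v \<longleftrightarrow>
     (\<forall>i \<in> simplex_indices TYPE('n). \<forall>j \<in> simplex_indices TYPE('n). i \<noteq> j \<longrightarrow>
        rel_interior (ridge_opposite v i j) \<inter> (klein_ball \<union> klein_sphere) \<noteq> {})"

definition truncation_base ::
    "(nat \<Rightarrow> 'n::finite lorentz) \<Rightarrow> 'n lorentz \<Rightarrow> 'n lorentz set" where
  "truncation_base v w = polar_hyperplane w \<inter> spanned_simplex v"

definition truncation_pyramid ::
    "(nat \<Rightarrow> 'n::finite lorentz) \<Rightarrow> 'n lorentz \<Rightarrow> 'n lorentz set" where
  "truncation_pyramid v w = convex hull (insert w (truncation_base v w))"

text \<open>
  What it means for the truncation at \<open>w\<close> to be the omission of a pyramid with apex \<open>w\<close> whose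
  base is an \<open>(n - 1)\<close>-simplex: the pyramid is the piece of the simplex that the polar hyperplane
  cuts off on the side of \<open>w\<close>, and of the vertices of the simplex it contains the apex only. In
  particular the vertices of the base are new. None of this is automatic: the other vertices may
  lie on the polar hyperplane of \<open>w\<close> or on the same side of it as \<open>w\<close>.
\<close>

definition truncatable_at :: "(nat \<Rightarrow> 'n::finite lorentz) \<Rightarrow> 'n lorentz \<Rightarrow> bool" where
  "truncatable_at v w \<longleftrightarrow>
     (int CARD('n) - 1) simplex (truncation_base v w) \<and>
     truncation_pyramid v w = {x \<in> spanned_simplex v. lorentz_inner x (unit_multiple w) \<ge> 0} \<and>
     truncation_pyramid v w \<inter> vertex_set v = {w}"

definition truncated_simplex :: "(nat \<Rightarrow> 'n::finite lorentz) \<Rightarrow> 'n lorentz set" where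
  "truncated_simplex v =
     spanned_simplex v -
       (\<Union>w \<in> vertex_set v \<inter> klein_exterior. truncation_pyramid v w - truncation_base v w)"

text \<open>
  \<open>generalized_simplex v P\<close>: the polyhedron \<open>P\<close> is a generalized simplex with vertices
  \<open>v 1, \<dots>, v (n + 1)\<close>; these are the vertices of the simplex before truncation. As usual, truncated
  simplices are normalized by an isometry so that the simplex contains the origin of the chart.
\<close>

definition ordinary_simplex :: "(nat \<Rightarrow> 'n::finite lorentz) \<Rightarrow> 'n lorentz set \<Rightarrow> bool" where
  "ordinary_simplex v P \<longleftrightarrow>
     simplex_vertices v \<and> vertex_set v \<subseteq> klein_ball \<union> klein_sphere \<and> P = spanned_simplex v"

definition polar_truncated_simplex :: "(nat \<Rightarrow> 'n::finite lorentz) \<Rightarrow> 'n lorentz set \<Rightarrow> bool" where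
  "polar_truncated_simplex v P \<longleftrightarrow>
     simplex_vertices v \<and>
     proj_origin \<in> spanned_simplex v \<and>
     ridges_meet_closed_ball v \<and>
     (\<forall>w \<in> vertex_set v \<inter> klein_exterior. truncatable_at v w) \<and>
     P = truncated_simplex v"

definition generalized_simplex :: "(nat \<Rightarrow> 'n::finite lorentz) \<Rightarrow> 'n lorentz set \<Rightarrow> bool" where
  "generalized_simplex v P \<longleftrightarrow> ordinary_simplex v P \<or> polar_truncated_simplex v P"

definition polyhedron_facet ::
    "(nat \<Rightarrow> 'n::finite lorentz) \<Rightarrow> 'n lorentz set \<Rightarrow> nat \<Rightarrow> 'n lorentz set" where
  "polyhedron_facet v P i = P \<inter> facet_opposite v i"

definition outward_unit_normal ::
    "(nat \<Rightarrow> 'n::finite lorentz) \<Rightarrow> 'n lorentz set \<Rightarrow> nat \<Rightarrow> 'n lorentz \<Rightarrow> bool" where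
  "outward_unit_normal v P i u \<longleftrightarrow>
     lorentz_inner u u = 1 \<and>
     (\<forall>x \<in> polyhedron_facet v P i. lorentz_inner u x = 0) \<and>
     (\<forall>x \<in> P. lorentz_inner u x \<le> 0)"

text \<open>
  The value \<open>\<theta> = 0\<close>, i.e. \<open>lorentz_inner u u' = -1\<close>, is the case of facets whose hyperplanes meet
  on the sphere at infinity but not inside the ball.
\<close>

definition has_dihedral_angle ::
    "(nat \<Rightarrow> 'n::finite lorentz) \<Rightarrow> 'n lorentz set \<Rightarrow> nat \<Rightarrow> nat \<Rightarrow> real \<Rightarrow> bool" where
  "has_dihedral_angle v P i j \<theta> \<longleftrightarrow>
     0 \<le> \<theta> \<and> \<theta> \<le> pi \<and>
     (\<exists>u u'. outward_unit_normal v P i u \<and> outward_unit_normal v P j u' \<and>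
             lorentz_inner u u' = - cos \<theta>)"

text \<open>
  Rows and columns of matrices are numbered from \<open>0\<close>, those of the Gram matrix and of its
  cofactors from \<open>1\<close>.
\<close>

definition gram_matrix :: "nat \<Rightarrow> (nat \<Rightarrow> nat \<Rightarrow> real) \<Rightarrow> real mat" where
  "gram_matrix n \<theta> = mat (n + 1) (n + 1) (\<lambda>(i, j). - cos (\<theta> (i + 1) (j + 1)))"

definition gram_cofactor :: "nat \<Rightarrow> (nat \<Rightarrow> nat \<Rightarrow> real) \<Rightarrow> nat \<Rightarrow> nat \<Rightarrow> real" where
  "gram_cofactor n \<theta> i j =
     (-1) ^ (i + j) * Determinant.det (mat_delete (gram_matrix n \<theta>) (i - 1) (j - 1))"

text \<open>
  The numbers of positive and of negative eigenvalues, counted with multiplicity. For real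
  symmetric matrices algebraic and geometric multiplicities agree.
\<close>

definition matrix_signature :: "real mat \<Rightarrow> nat \<times> nat" where
  "matrix_signature A =
     ((\<Sum>x | eigenvalue A x \<and> x > 0. Polynomial.order x (char_poly A)),
      (\<Sum>x | eigenvalue A x \<and> x < 0. Polynomial.order x (char_poly A)))"

end

theory Submission
  imports Defs
begin

text \<open>
  Let \<open>v\<^sub>i\<close> be the vertices of the simplex and \<open>u\<^sub>i\<close> the outward unit normals of its facets. Each
  \<open>u\<^sub>i\<close> is orthogonal to all vertices but \<open>v\<^sub>i\<close>, so up to scaling the two families are dual bases for
  the Lorentz form. The matrix \<open>G = (- cos \<theta>\<^sub>i\<^sub>j)\<close> is the Gram matrix of the \<open>u\<^sub>i\<close>; its inverse is
  therefore the Gram matrix of the rescaled \<open>v\<^sub>i\<close>, and Cramer's rule turns this into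
  \<open>c\<^sub>i\<^sub>j = det G * \<langle>v\<^sub>i, v\<^sub>j\<rangle> / (\<langle>u\<^sub>i, v\<^sub>i\<rangle> \<langle>u\<^sub>j, v\<^sub>j\<rangle>)\<close> (lemma \<open>gram_cofactor_eq\<close>). A Gram matrix of
  a basis of Lorentzian space has signature \<open>(n, 1)\<close> and negative determinant, whereas
  \<open>\<langle>u\<^sub>i, v\<^sub>i\<rangle> < 0\<close>. So the cofactor condition says exactly that \<open>\<langle>v\<^sub>i, v\<^sub>j\<rangle> < 0\<close> for \<open>i \<noteq> j\<close>.

  From a generalized simplex to the matrix: two distinct points of the closed ball have negative
  product by the strict Cauchy-Schwarz inequality, and if \<open>v\<^sub>i\<close> lies outside the closed ball, the
  truncation at \<open>v\<^sub>i\<close> separates it from all other vertices by its polar hyperplane, which says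
  \<open>\<langle>v\<^sub>i, v\<^sub>j\<rangle> < 0\<close> again. The point that needs care is that a normal of the truncated polyhedron is a
  normal of the simplex: the truncated facet must still span its hyperplane. It does because every
  facet contains a point that has negative product with all vertices. Such a point is found by
  minimizing \<open>\<langle>x, x\<rangle>\<close> over the facet; this is a Perron-Frobenius argument for the matrix
  \<open>(- \<langle>v\<^sub>k, v\<^sub>l\<rangle>)\<close>, whose off-diagonal entries are positive
  (lemma \<open>exists_hull_point_negative_on_vertices\<close>).

  From the matrix to a generalized simplex: diagonalizing \<open>G\<close> realizes it as the Gram matrix of
  vectors \<open>u\<^sub>i\<close>, whose dual family \<open>w\<^sub>i\<close> has negative mutual products. The same minimization over the
  hull of all \<open>w\<^sub>i\<close> gives a timelike \<open>x\<close> with \<open>\<langle>x, w\<^sub>i\<rangle> < 0\<close> for all \<open>i\<close>. After a Lorentz reflection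
  taking \<open>x\<close> to the origin of the chart, every \<open>w\<^sub>i\<close> has positive first coordinate and can be scaled
  into the chart, and the simplex so obtained contains the origin (lemma
  \<open>exists_normalized_dual\<close>). The hypothesis \<open>\<theta>\<^sub>i\<^sub>j \<in> [0, \<pi>)\<close> makes the span of \<open>u\<^sub>i\<close> and \<open>u\<^sub>j\<close> positive
  semidefinite, so its orthogonal complement, the span of a ridge, contains a nonzero vector that is
  not spacelike. Taking absolute values of its coefficients, and moving zero coefficients slightly
  into the positive, gives a point of the closed ball in the interior of the ridge (lemma
  \<open>exists_positive_combination\<close>).
\<close>

section \<open>Diagonalization of real symmetric matrices and the signature\<close>

text \<open>
  The first-order condition at a one-sided minimum of a quadratic function: the linear term dominates
  near \<open>0\<close>. All minimization arguments below end in this inequality, and its contrapositive supplies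
  the small parameters.
\<close>

lemma linear_coeff_nonneg:
  fixes a b :: real
  assumes "\<And>t. 0 < t \<Longrightarrow> t \<le> 1 \<Longrightarrow> 0 \<le> a * t + b * t\<^sup>2"
  shows "0 \<le> a"
proof (rule ccontr)
  assume a: "\<not> 0 \<le> a"
  define t where "t = min 1 (- a / (2 * (\<bar>b\<bar> + 1)))"
  have t: "0 < t" "t \<le> 1" using a by (auto simp: t_def field_simps)
  have "\<bar>b\<bar> * t \<le> (\<bar>b\<bar> + 1) * (- a / (2 * (\<bar>b\<bar> + 1)))"
    using t by (intro mult_mono) (auto simp: t_def)
  also have "\<dots> = - a / 2" by (simp add: field_simps)
  finally have "b * t \<le> - a / 2" using t by (smt (verit) mult_right_mono)
  then have "(a + b * t) * t < 0" using a t by (intro mult_neg_pos) auto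
  with assms[OF t] show False by (simp add: power2_eq_square algebra_simps)
qed

text \<open>
  The Rayleigh quotient attains its maximum on the unit sphere of \<open>S\<close>, and a maximizer is an
  eigenvector.
\<close>

lemma selfadjoint_eigenvector:
  fixes f :: "'a::euclidean_space \<Rightarrow> 'a"
  assumes lin: "linear f" and sa: "\<And>x y. inner (f x) y = inner x (f y)"
    and S: "subspace S" "f ` S \<subseteq> S" "S \<noteq> {0}"
  obtains x c where "x \<in> S" "norm x = 1" "f x = c *\<^sub>R x"
proof -
  interpret f: linear f by fact
  let ?K = "S \<inter> sphere 0 1"
  have "compact ?K" using closed_subspace[OF S(1)] by (simp add: closed_Int_compact)
  moreover have "?K \<noteq> {}"
  proof -
    obtain z where "z \<in> S" "z \<noteq> 0" using S subspace_0[OF S(1)] by blast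
    then have "z /\<^sub>R norm z \<in> ?K" using S(1) by (simp add: subspace_scale)
    then show ?thesis by blast
  qed
  moreover have "continuous_on ?K (\<lambda>x. inner (f x) x)"
    by (intro continuous_intros linear_continuous_on linear_conv_bounded_linear[THEN iffD1] lin)
  ultimately obtain x where x: "x \<in> ?K"
    and mx: "\<And>y. y \<in> ?K \<Longrightarrow> inner (f y) y \<le> inner (f x) x"
    using continuous_attains_sup[of ?K "\<lambda>x. inner (f x) x"] by blast
  define c where "c = inner (f x) x"
  have q: "inner (f y) y \<le> c * inner y y" if "y \<in> S" for y
  proof (cases "y = 0")
    case False
    then have "y /\<^sub>R norm y \<in> ?K" using that S(1) by (simp add: subspace_scale)
    then show ?thesis using mx[of "y /\<^sub>R norm y"] False
      by (simp add: c_def f.scale field_simps power2_norm_eq_inner flip: power2_eq_square)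
  qed (simp add: f.zero)
  define g where "g = f x - c *\<^sub>R x"
  have xx: "inner x x = 1" using x by (simp add: dot_square_norm)
  have gS: "g \<in> S" using x S by (auto simp: g_def subspace_diff subspace_scale)
  \<comment> \<open>The derivative of the Rayleigh quotient at \<open>x\<close> in the direction of the defect \<open>g\<close> is a multiple
      of \<open>inner g g\<close>; it cannot be positive, so \<open>g = 0\<close>.\<close>
  have "0 \<le> - 2 * inner g g"
  proof (rule linear_coeff_nonneg[where b = "c * inner g g - inner (f g) g"])
    fix t :: real
    have fg: "inner (f g) x = inner g g + c * inner x g"
      unfolding sa[of g x] by (simp add: g_def algebra_simps inner_commute)
    have gx: "inner x g = 0" using xx by (simp add: g_def c_def inner_commute algebra_simps)
    have fxg: "inner (f x) g = inner g g" using fg gx sa[of x g] by (simp add: inner_commute)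
    have "x + t *\<^sub>R g \<in> S" using x gS S by (simp add: subspace_add subspace_scale)
    from q[OF this] show "0 \<le> - 2 * inner g g * t + (c * inner g g - inner (f g) g) * t\<^sup>2"
      using fg gx fxg xx c_def
      by (simp add: f.add f.scale inner_simps inner_commute power2_eq_square algebra_simps)
  qed
  then have "g = 0" using inner_ge_zero[of g] by auto
  then show thesis using that[of x c] x by (simp add: g_def)
qed

text \<open>
  Split off one eigenvector at a time: its orthogonal complement in \<open>S\<close> is invariant because \<open>f\<close> is
  self-adjoint.
\<close>

lemma selfadjoint_orthonormal_eigenbasis:
  fixes f :: "'a::euclidean_space \<Rightarrow> 'a"
  assumes lin: "linear f" and sa: "\<And>x y. inner (f x) y = inner x (f y)"
    and "subspace S" "f ` S \<subseteq> S"
  shows "\<exists>B. pairwise real_inner_class.orthogonal B \<and> (\<forall>b\<in>B. norm b = 1 \<and> (\<exists>c. f b = c *\<^sub>R b)) \<and> span B = S"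
  using assms(3,4)
proof (induction "dim S" arbitrary: S rule: less_induct)
  case less
  interpret f: linear f by fact
  show ?case
  proof (cases "S = {0}")
    case True
    then show ?thesis by (intro exI[of _ "{}"]) auto
  next
    case False
    obtain x c where x: "x \<in> S" "norm x = 1" "f x = c *\<^sub>R x"
      using selfadjoint_eigenvector[OF lin sa less.prems False] by blast
    define T where "T = {y \<in> S. inner x y = 0}"
    have subT: "subspace T" using less.prems(1)
      by (auto simp: T_def subspace_def inner_simps)
    have "inner x (f y) = 0" if "inner x y = 0" for y
      using sa[of x y] x that by simp
    then have fT: "f ` T \<subseteq> T" using less.prems(2) by (auto simp: T_def)
    have xx: "inner x x = 1" using x by (simp add: dot_square_norm)
    then have "x \<notin> T" by (simp add: T_def)
    then have "T \<subset> S" using x(1) by (force simp: T_def)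
    then have "dim T < dim S"
      using dim_psubset[of T S] subT less.prems(1) by (simp add: span_eq_iff[THEN iffD2])
    from less.hyps[OF this subT fT] obtain B where B: "pairwise real_inner_class.orthogonal B"
      "\<forall>b\<in>B. norm b = 1 \<and> (\<exists>c. f b = c *\<^sub>R b)" "span B = T" by blast
    have "B \<subseteq> T" using B(3) span_superset by blast
    then have "pairwise real_inner_class.orthogonal (insert x B)"
      using B(1) by (auto simp: pairwise_insert T_def real_inner_class.orthogonal_def inner_commute)
    moreover have "span (insert x B) = S"
    proof
      show "span (insert x B) \<subseteq> S"
        using \<open>B \<subseteq> T\<close> x less.prems(1) by (intro span_minimal) (auto simp: T_def)
      show "S \<subseteq> span (insert x B)"
      proof
        fix y assume "y \<in> S"
        then have "y - inner x y *\<^sub>R x \<in> T"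
          using x xx less.prems(1) by (auto simp: T_def subspace_diff subspace_scale inner_simps)
        then show "y \<in> span (insert x B)" using B(3) by (auto simp: span_insert)
      qed
    qed
    ultimately show ?thesis using B(2) x by (intro exI[of _ "insert x B"]) auto
  qed
qed

text \<open>
  The matrix is read as a self-adjoint operator on \<open>real ^ 'k\<close> in coordinates \<open>h\<close> enumerating the
  standard basis; the columns of \<open>Q\<close> are the coordinates of an orthonormal eigenbasis.
\<close>

lemma symmetric_mat_diagonalization:
  fixes A :: "real mat"
  assumes A: "A \<in> carrier_mat CARD('k::finite) CARD('k)" and sym: "A\<^sup>T = A"
  obtains Q d where "Q \<in> carrier_mat CARD('k) CARD('k)" "Q\<^sup>T * Q = 1\<^sub>m CARD('k)"
    "A = Q * mat_diag CARD('k) d * Q\<^sup>T"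
proof -
  define N where "N = CARD('k)"
  obtain h where h: "bij_betw h {0..<N} (Basis :: (real^'k) set)"
    using ex_bij_betw_nat_finite[of "Basis :: (real^'k) set"] by (auto simp: N_def)
  have hB: "h i \<in> Basis" if "i < N" for i using h that by (auto simp: bij_betw_def)
  have hh: "inner (h i) (h j) = (if i = j then 1 else 0)" if "i < N" "j < N" for i j
    using that hB h by (auto simp: inner_Basis bij_betw_def inj_on_def)
  have parseval: "inner x y = (\<Sum>i<N. inner (h i) x * inner (h i) y)" for x y
    using sum.reindex_bij_betw[OF h, of "\<lambda>b. inner b x * inner b y"]
    by (subst euclidean_inner) (simp add: inner_commute lessThan_atLeast0)
  have symA: "A $$ (i, j) = A $$ (j, i)" if "i < N" "j < N" for i j
    using sym A that by (metis N_def carrier_matD index_transpose_mat(1))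
  define f where "f y = (\<Sum>i<N. (\<Sum>j<N. A $$ (i, j) * inner (h j) y) *\<^sub>R h i)" for y
  have lin: "linear f"
    by (rule linearI) (simp_all add: f_def inner_simps algebra_simps sum.distrib
        scaleR_left.sum sum_distrib_left scaleR_right.sum)
  have hf: "inner (h i) (f y) = (\<Sum>j<N. A $$ (i, j) * inner (h j) y)" if "i < N" for i y
  proof -
    have "inner (h i) (f y) = (\<Sum>k<N. (\<Sum>j<N. A $$ (k, j) * inner (h j) y) * inner (h i) (h k))"
      by (simp add: f_def inner_sum_right)
    also have "\<dots> = (\<Sum>k<N. if k = i then (\<Sum>j<N. A $$ (k, j) * inner (h j) y) else 0)"
      using that by (intro sum.cong) (auto simp: hh)
    finally show ?thesis using that by simp
  qed
  have sa: "inner (f x) y = inner x (f y)" for x y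
  proof -
    have "inner (f x) y = (\<Sum>i<N. \<Sum>j<N. A $$ (i, j) * inner (h j) x * inner (h i) y)"
      by (subst parseval) (simp add: hf sum_distrib_right)
    also have "\<dots> = (\<Sum>j<N. \<Sum>i<N. A $$ (j, i) * inner (h j) x * inner (h i) y)"
      by (subst sum.swap) (intro sum.cong, auto simp: symA)
    also have "\<dots> = inner x (f y)"
      by (subst parseval) (simp add: hf sum_distrib_left ac_simps)
    finally show ?thesis .
  qed
  obtain B where B: "pairwise real_inner_class.orthogonal B" "\<forall>b\<in>B. norm b = 1 \<and> (\<exists>c. f b = c *\<^sub>R b)"
    "span B = UNIV"
    using selfadjoint_orthonormal_eigenbasis[OF lin sa, of UNIV] by auto
  have indB: "independent B"
    using B by (intro pairwise_orthogonal_independent) auto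
  then have "card B = N"
    using B(3) by (metis dim_UNIV dim_span basis_card_eq_dim DIM_cart DIM_real N_def mult.right_neutral
        dim_eq_card_independent)
  then obtain q where q: "bij_betw q {0..<N} B"
    using ex_bij_betw_nat_finite[OF independent_imp_finite[OF indB]] by auto
  have qB: "q i \<in> B" if "i < N" for i using q that by (auto simp: bij_betw_def)
  have "\<exists>c. f (q k) = c *\<^sub>R q k" if "k < N" for k using B(2) qB[OF that] by blast
  then obtain d where d: "\<And>k. k < N \<Longrightarrow> f (q k) = d k *\<^sub>R q k" by metis
  have qq: "inner (q i) (q j) = (if i = j then 1 else 0)" if "i < N" "j < N" for i j
  proof (cases "i = j")
    case True
    then show ?thesis using B(2) qB[OF that(1)] by (simp add: dot_square_norm)
  next
    case False
    then have "q i \<noteq> q j" using q that by (auto simp: bij_betw_def inj_on_def)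
    then show ?thesis using B(1) qB that False by (auto simp: pairwise_def real_inner_class.orthogonal_def)
  qed
  define Q where "Q = mat N N (\<lambda>(i, k). inner (h i) (q k))"
  have Q: "Q \<in> carrier_mat N N" by (simp add: Q_def)
  have QQ: "Q\<^sup>T * Q = 1\<^sub>m N"
  proof (rule eq_matI)
    fix i j assume ij: "i < dim_row (1\<^sub>m N)" "j < dim_col (1\<^sub>m N)"
    then have "(Q\<^sup>T * Q) $$ (i, j) = inner (q i) (q j)"
      by (simp add: Q_def scalar_prod_def parseval[of "q i"] lessThan_atLeast0)
    then show "(Q\<^sup>T * Q) $$ (i, j) = 1\<^sub>m N $$ (i, j)" using ij qq by simp
  qed (simp_all add: Q_def)
  have AQ: "A * Q = Q * mat_diag N d"
  proof (rule eq_matI)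
    fix i k assume "i < dim_row (Q * mat_diag N d)" "k < dim_col (Q * mat_diag N d)"
    then have ik: "i < N" "k < N" by (simp_all add: Q_def mat_diag_def)
    have "(A * Q) $$ (i, k) = inner (h i) (f (q k))"
      using A ik by (simp add: Q_def scalar_prod_def hf lessThan_atLeast0 N_def)
    also have "\<dots> = (Q * mat_diag N d) $$ (i, k)"
      using ik d by (subst mat_diag_mult_right[OF Q]) (simp add: Q_def)
    finally show "(A * Q) $$ (i, k) = (Q * mat_diag N d) $$ (i, k)" .
  qed (use A in \<open>simp_all add: Q_def mat_diag_def N_def\<close>)
  have "Q * Q\<^sup>T = 1\<^sub>m N" using mat_mult_left_right_inverse[of "Q\<^sup>T" N Q] Q QQ by simp
  then have "A = (A * Q) * Q\<^sup>T"
    using A Q assoc_mult_mat[of A N N Q N "Q\<^sup>T" N] by (simp add: N_def)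
  then have "A = Q * mat_diag N d * Q\<^sup>T" by (simp add: AQ)
  then show thesis using that Q QQ by (simp add: N_def)
qed

lemma order_prod_linear:
  fixes d :: "'b \<Rightarrow> 'a::idom"
  assumes "finite K"
  shows "Polynomial.order x (\<Prod>k\<in>K. [:- d k, 1:]) = card {k \<in> K. d k = x}"
  using assms
proof (induction K)
  case (insert k K)
  have nz: "(\<Prod>k\<in>K. [:- d k, 1:]) \<noteq> 0" using insert by simp
  have "{j \<in> insert k K. d j = x} = (if d k = x then insert k {j \<in> K. d j = x} else {j \<in> K. d j = x})"
    by auto
  moreover have "Polynomial.order x [:- d k, 1:] = (if d k = x then 1 else 0)"
    using order_power_n_n[of x 1] by (auto intro: order_0I)
  moreover have "[:- d k, 1:] * (\<Prod>k\<in>K. [:- d k, 1:]) \<noteq> 0"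
    using nz by (metis mult_eq_0_iff pCons_eq_0_iff zero_neq_one)
  ultimately show ?case
    unfolding prod.insert[OF insert.hyps] using insert
    by (subst order_mult) auto
qed (simp add: order_0I)

text \<open>
  An orthogonal diagonalization is a similarity, so the characteristic polynomial is
  \<open>\<Prod>k<N. (x - d k)\<close>, and counting roots with multiplicity is counting diagonal entries.
\<close>

lemma matrix_signature_diagonalization:
  assumes Q: "Q \<in> carrier_mat N N" "Q\<^sup>T * Q = 1\<^sub>m N" and A: "A = Q * mat_diag N d * Q\<^sup>T"
  shows "matrix_signature A = (card {k. k < N \<and> d k > 0}, card {k. k < N \<and> d k < 0})"
proof -
  have QQ: "Q * Q\<^sup>T = 1\<^sub>m N" using mat_mult_left_right_inverse[of "Q\<^sup>T" N Q] Q by simp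
  have Ac: "A \<in> carrier_mat N N" unfolding A using Q by (intro mult_carrier_mat[of _ N N]) simp_all
  have "similar_mat A (mat_diag N d)"
    using Q QQ A Ac by (intro similar_matI[of _ _ Q "Q\<^sup>T" N]) auto
  then have "char_poly A = char_poly (mat_diag N d)" by (rule char_poly_similar)
  also have "\<dots> = (\<Prod>k\<in>{..<N}. [:- d k, 1:])"
    by (subst char_poly_upper_triangular[of _ N])
       (auto simp: mat_diag_def diag_mat_def o_def lessThan_atLeast0 intro!: arg_cong[of _ _ prod_list]
          simp flip: interv_sum_list_conv_sum_set_nat prod.distinct_set_conv_list)
  finally have cp: "char_poly A = (\<Prod>k\<in>{..<N}. [:- d k, 1:])" .
  have ev: "eigenvalue A x \<longleftrightarrow> (\<exists>k<N. d k = x)" for x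
    unfolding eigenvalue_root_char_poly[OF Ac] cp by (auto simp: poly_prod)
  have ord: "Polynomial.order x (char_poly A) = card {k \<in> {..<N}. d k = x}" for x
    unfolding cp by (rule order_prod_linear) simp
  have count: "(\<Sum>x | eigenvalue A x \<and> R x. Polynomial.order x (char_poly A)) = card {k. k < N \<and> R (d k)}" for R
  proof -
    let ?K = "{k. k < N \<and> R (d k)}"
    have "(\<Sum>x | eigenvalue A x \<and> R x. Polynomial.order x (char_poly A)) = (\<Sum>x\<in>d ` ?K. card {k \<in> ?K. d k = x})"
      unfolding ord ev by (intro sum.cong) (auto intro!: arg_cong[of _ _ card])
    also have "\<dots> = card ?K"
      by (subst card_eq_sum, subst sum.image_gen[of ?K _ d]) auto
    finally show ?thesis .
  qed
  show ?thesis unfolding matrix_signature_def count ..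
qed

lemma det_diagonalization:
  fixes A :: "real mat"
  assumes Q: "Q \<in> carrier_mat N N" "Q\<^sup>T * Q = 1\<^sub>m N" and A: "A = Q * mat_diag N d * Q\<^sup>T"
  shows "Determinant.det A = (\<Prod>k<N. d k)"
proof -
  have "Determinant.det Q * Determinant.det Q = 1"
    using det_mult[of "Q\<^sup>T" N Q] det_transpose[OF Q(1)] Q by simp
  moreover have "Determinant.det (mat_diag N d) = (\<Prod>k<N. d k)"
    by (subst det_upper_triangular[of _ N])
       (auto simp: mat_diag_def diag_mat_def o_def lessThan_atLeast0 simp flip: prod.distinct_set_conv_list)
  ultimately show ?thesis
    using Q mat_diag_dim[of N d] by (simp add: A det_mult[of _ N] det_transpose)
qed

section \<open>The Lorentz form and the Klein model\<close>

notation lorentz_inner (infixl "\<star>" 70)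

interpretation lorentz: bounded_bilinear "lorentz_inner :: 'n::finite lorentz \<Rightarrow> _ \<Rightarrow> real"
  by (rule bilinear_conv_bounded_bilinear[THEN iffD1])
     (auto simp: bilinear_def lorentz_inner_def inner_simps algebra_simps intro!: linearI)

lemmas lorentz_simps = lorentz.add_left lorentz.add_right lorentz.diff_left lorentz.diff_right
  lorentz.scaleR_left lorentz.scaleR_right lorentz.minus_left lorentz.minus_right

lemma lorentz_commute: "x \<star> y = y \<star> x"
  by (simp add: lorentz_inner_def inner_commute)

lemma lorentz_nondegenerate:
  assumes "\<And>y. x \<star> y = 0"
  shows "x = 0"
proof -
  have "x \<star> (- fst x, snd x) = (fst x)\<^sup>2 + (norm (snd x))\<^sup>2"
    by (simp add: lorentz_inner_def power2_eq_square flip: power2_norm_eq_inner)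
  then show ?thesis using assms by (simp add: prod_eq_iff sum_power2_eq_zero_iff)
qed

lemma lorentz_spacelike_if_fst_0:
  assumes "fst x = 0"
  shows "0 \<le> x \<star> x" "x \<noteq> 0 \<Longrightarrow> 0 < x \<star> x"
  using assms by (auto simp: lorentz_inner_def prod_eq_iff)

lemma lorentz_proj_origin [simp]: "proj_origin \<star> x = - fst x"
  by (simp add: lorentz_inner_def proj_origin_def)

lemma klein_iff:
  assumes "x \<in> proj_plane"
  shows "x \<in> klein_ball \<longleftrightarrow> x \<star> x < 0" "x \<in> klein_sphere \<longleftrightarrow> x \<star> x = 0"
    "x \<in> klein_exterior \<longleftrightarrow> 0 < x \<star> x"
proof -
  have "dist x proj_origin = norm (snd x)"
    using assms by (simp add: proj_plane_def proj_origin_def dist_prod_def)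
  moreover have "x \<star> x = (norm (snd x))\<^sup>2 - 1"
    using assms by (simp add: proj_plane_def lorentz_inner_def power2_norm_eq_inner)
  moreover have "norm (snd x) < 1 \<longleftrightarrow> (norm (snd x))\<^sup>2 < 1" "norm (snd x) = 1 \<longleftrightarrow> (norm (snd x))\<^sup>2 = 1"
    by (simp_all add: power_less_one_iff power2_eq_1_iff) (smt (verit) norm_ge_zero)
  ultimately show "x \<in> klein_ball \<longleftrightarrow> x \<star> x < 0" "x \<in> klein_sphere \<longleftrightarrow> x \<star> x = 0"
    "x \<in> klein_exterior \<longleftrightarrow> 0 < x \<star> x"
    using assms by (auto simp: klein_ball_def klein_sphere_def klein_exterior_def)
qed

lemma unit_multiple_sign:
  assumes "0 < w \<star> w"
  shows "x \<star> unit_multiple w = 0 \<longleftrightarrow> x \<star> w = 0" "0 \<le> x \<star> unit_multiple w \<longleftrightarrow> 0 \<le> x \<star> w"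
  using assms by (auto simp: unit_multiple_def lorentz_simps zero_le_mult_iff zero_le_divide_iff divide_inverse)

text \<open>
  Strict Cauchy-Schwarz in the chart: the difference \<open>x - y\<close> has vanishing first coordinate and is
  therefore spacelike.
\<close>

lemma lorentz_neg_closed_ball:
  assumes "x \<in> proj_plane" "y \<in> proj_plane" "x \<star> x \<le> 0" "y \<star> y \<le> 0" "x \<noteq> y"
  shows "x \<star> y < 0"
proof -
  have "0 < (x - y) \<star> (x - y)"
    using assms by (intro lorentz_spacelike_if_fst_0) (auto simp: proj_plane_def)
  also have "\<dots> = x \<star> x + y \<star> y - 2 * (x \<star> y)"
    by (simp add: lorentz_simps lorentz_commute[of y x])
  finally show ?thesis using assms by linarith
qed

section \<open>Vectors with negative mutual products\<close>

lemma lorentz_sum_self: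
  "(\<Sum>k\<in>K. a k *\<^sub>R v k) \<star> (\<Sum>k\<in>K. a k *\<^sub>R v k) = (\<Sum>k\<in>K. \<Sum>l\<in>K. a k * a l * (v k \<star> v l))"
  by (subst lorentz.sum_left, subst lorentz.sum_right) (simp add: lorentz_simps ac_simps)

text \<open>
  Coefficients belong to indices rather than to points, as in all sums over vertices below.
\<close>

lemma convex_hull_finite_image:
  fixes v :: "'i \<Rightarrow> 'a::real_vector"
  assumes "finite K"
  shows "convex hull (v ` K) = {\<Sum>k\<in>K. a k *\<^sub>R v k | a. (\<forall>k\<in>K. 0 \<le> a k) \<and> sum a K = 1}" (is "_ = ?C")
proof
  show "?C \<subseteq> convex hull (v ` K)"
    using assms by (auto intro!: convex_sum[OF _ convex_convex_hull] intro: hull_inc)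
  have "v k \<in> ?C" if "k \<in> K" for k
    using that assms
    by (auto intro!: exI[of _ "\<lambda>l. if l = k then 1 else 0"] simp: if_distrib[of "\<lambda>c. c *\<^sub>R _"] cong: if_cong)
  moreover have "convex ?C"
  proof (rule convexI)
    fix x y :: 'a and s t :: real assume "x \<in> ?C" "y \<in> ?C" and st: "0 \<le> s" "0 \<le> t" "s + t = 1"
    then obtain a b where a: "\<forall>k\<in>K. 0 \<le> a k" "sum a K = 1" "x = (\<Sum>k\<in>K. a k *\<^sub>R v k)"
      and b: "\<forall>k\<in>K. 0 \<le> b k" "sum b K = 1" "y = (\<Sum>k\<in>K. b k *\<^sub>R v k)" by auto
    have "s *\<^sub>R x + t *\<^sub>R y = (\<Sum>k\<in>K. (s * a k + t * b k) *\<^sub>R v k)"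
      by (simp add: a b scaleR_sum_right sum.distrib scaleR_add_left)
    moreover have "(\<Sum>k\<in>K. s * a k + t * b k) = 1"
      using a b st by (simp add: sum.distrib flip: sum_distrib_left)
    ultimately show "s *\<^sub>R x + t *\<^sub>R y \<in> ?C"
      using a b st by (auto intro!: exI[of _ "\<lambda>k. s * a k + t * b k"])
  qed
  ultimately show "convex hull (v ` K) \<subseteq> ?C" by (intro hull_minimal) auto
qed

text \<open>
  Used with \<open>f k\<close> the product of \<open>v k\<close> with a fixed vector; only the terms of positive weight matter,
  so that \<open>f\<close> may be nonnegative where the weight vanishes.
\<close>

lemma weighted_sum_neg:
  fixes a f :: "'i \<Rightarrow> real"
  assumes "finite K" "\<And>k. k \<in> K \<Longrightarrow> 0 \<le> a k" "\<exists>k\<in>K. 0 < a k"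
    "\<And>k. k \<in> K \<Longrightarrow> 0 < a k \<Longrightarrow> f k < 0"
  shows "(\<Sum>k\<in>K. a k * f k) < 0"
proof -
  have "0 < (\<Sum>k\<in>K. a k * - f k)"
  proof -
    obtain k where "k \<in> K" "0 < a k" using assms by blast
    moreover have "0 \<le> a l * - f l" if "l \<in> K" for l
      using assms(2)[OF that] assms(4)[OF that] by (cases "a l = 0") (auto simp: mult_nonneg_nonpos)
    ultimately show ?thesis using assms(1,4)
      by (intro sum_pos2[of K k]) (auto simp: mult_pos_neg)
  qed
  then show ?thesis by (simp add: sum_negf)
qed

text \<open>
  The point minimizes \<open>x \<star> x\<close> over the hull. Minimality gives \<open>x \<star> x \<le> x \<star> v k\<close> for all \<open>k\<close>. If \<open>v k\<close>
  has positive weight in \<open>x\<close>, equality holds and the value is negative, being at most \<open>y \<star> y\<close>; if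
  \<open>v k\<close> has weight \<open>0\<close>, then \<open>x \<star> v k\<close> is a combination of products of distinct vertices, which are
  negative. In matrix terms this finds \<open>a \<ge> 0\<close> with \<open>A a > 0\<close> for a symmetric matrix \<open>A\<close> with positive
  off-diagonal entries that takes a positive value as a quadratic form on a nonnegative vector; the
  Perron vector of \<open>A\<close> would serve as well.
\<close>

lemma exists_hull_point_negative_on_vertices:
  fixes v :: "'i \<Rightarrow> 'n::finite lorentz"
  assumes fin: "finite K"
    and neg: "\<And>k l. k \<in> K \<Longrightarrow> l \<in> K \<Longrightarrow> k \<noteq> l \<Longrightarrow> v k \<star> v l < 0"
    and y: "y \<in> convex hull (v ` K)" "y \<star> y < 0"
  obtains x where "x \<in> convex hull (v ` K)" "\<And>k. k \<in> K \<Longrightarrow> x \<star> v k < 0"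
proof -
  let ?H = "convex hull (v ` K)"
  have "compact ?H" using fin by (simp add: finite_imp_compact_convex_hull)
  moreover have "continuous_on ?H (\<lambda>x. x \<star> x)" by (intro lorentz.continuous_on continuous_on_id)
  ultimately obtain x where x: "x \<in> ?H" and mn: "\<And>z. z \<in> ?H \<Longrightarrow> x \<star> x \<le> z \<star> z"
    using continuous_attains_inf[of ?H "\<lambda>x. x \<star> x"] y by blast
  have xx: "x \<star> x < 0" using mn[OF y(1)] y(2) by linarith
  have var: "x \<star> x \<le> x \<star> z" if z: "z \<in> ?H" for z
  proof -
    have "0 \<le> 2 * (x \<star> (z - x))"
    proof (rule linear_coeff_nonneg[where b = "(z - x) \<star> (z - x)"])
      fix t :: real assume t: "0 < t" "t \<le> 1"
      have "(1 - t) *\<^sub>R x + t *\<^sub>R z \<in> ?H"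
        using t x z by (intro convexD[OF convex_convex_hull]) auto
      from mn[OF this] show "0 \<le> 2 * (x \<star> (z - x)) * t + (z - x) \<star> (z - x) * t\<^sup>2"
        by (simp add: lorentz_simps lorentz_commute[of z x] power2_eq_square algebra_simps)
    qed
    then show ?thesis by (simp add: lorentz_simps)
  qed
  obtain a where a: "\<And>k. k \<in> K \<Longrightarrow> 0 \<le> a k" "sum a K = 1" "x = (\<Sum>k\<in>K. a k *\<^sub>R v k)"
    using x unfolding convex_hull_finite_image[OF fin] by auto
  \<comment> \<open>Complementary slackness: the weighted sum of the nonnegative slacks \<open>x \<star> v k - x \<star> x\<close> is zero.\<close>
  have "(\<Sum>k\<in>K. a k * (x \<star> v k - x \<star> x)) = x \<star> (\<Sum>k\<in>K. a k *\<^sub>R v k) - sum a K * (x \<star> x)"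
    by (simp add: lorentz.sum_right lorentz_simps algebra_simps sum_subtractf sum_distrib_left)
  also have "\<dots> = 0" using a by simp
  finally have "\<forall>k\<in>K. a k * (x \<star> v k - x \<star> x) = 0"
    using fin a var by (subst (asm) sum_nonneg_eq_0_iff) (auto simp: hull_inc)
  then have pos: "x \<star> v k = x \<star> x" if "k \<in> K" "0 < a k" for k using that by auto
  have "x \<star> v k < 0" if k: "k \<in> K" for k
  proof (cases "0 < a k")
    case False
    have "\<exists>l\<in>K. 0 < a l" using a(1,2) by (metis less_eq_real_def sum.neutral zero_neq_one)
    then have "(\<Sum>l\<in>K. a l * (v l \<star> v k)) < 0"
      using fin a neg k False by (intro weighted_sum_neg) auto
    then show ?thesis by (simp add: a(3) lorentz.sum_left lorentz_simps)
  qed (use pos k xx in auto)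
  then show thesis using that x by blast
qed

text \<open>
  Diagonal terms do not change and off-diagonal terms can only decrease.
\<close>

lemma abs_coeffs_lorentz_le:
  fixes v :: "'i \<Rightarrow> 'n::finite lorentz"
  assumes neg: "\<And>k l. k \<in> K \<Longrightarrow> l \<in> K \<Longrightarrow> k \<noteq> l \<Longrightarrow> v k \<star> v l \<le> 0"
  defines "x \<equiv> \<lambda>b. \<Sum>k\<in>K. b k *\<^sub>R v k"
  shows "x (\<lambda>k. \<bar>b k\<bar>) \<star> x (\<lambda>k. \<bar>b k\<bar>) \<le> x b \<star> x b"
  unfolding x_def lorentz_sum_self
proof (intro sum_mono)
  fix k l assume kl: "k \<in> K" "l \<in> K"
  show "\<bar>b k\<bar> * \<bar>b l\<bar> * (v k \<star> v l) \<le> b k * b l * (v k \<star> v l)"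
  proof (cases "k = l")
    case False
    then show ?thesis using neg[OF kl] by (intro mult_right_mono_neg) (simp_all flip: abs_mult)
  qed simp
qed

text \<open>
  Absolute values of the coefficients make the vector \<open>x\<close> a nonnegative combination. Where a
  coefficient is zero, \<open>x\<close> has negative product with the corresponding vertex, so adding a small
  multiple \<open>t\<close> of these vertices decreases \<open>x \<star> x\<close> and makes all coefficients positive.
\<close>

lemma exists_positive_combination:
  fixes v :: "'i \<Rightarrow> 'n::finite lorentz"
  assumes fin: "finite K"
    and neg: "\<And>k l. k \<in> K \<Longrightarrow> l \<in> K \<Longrightarrow> k \<noteq> l \<Longrightarrow> v k \<star> v l < 0"
    and b: "\<exists>k\<in>K. b k \<noteq> 0" "(\<Sum>k\<in>K. b k *\<^sub>R v k) \<star> (\<Sum>k\<in>K. b k *\<^sub>R v k) \<le> 0"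
  obtains a where "\<And>k. k \<in> K \<Longrightarrow> 0 < a k" "sum a K = 1"
    "(\<Sum>k\<in>K. a k *\<^sub>R v k) \<star> (\<Sum>k\<in>K. a k *\<^sub>R v k) \<le> 0"
proof -
  define x where "x = (\<Sum>k\<in>K. \<bar>b k\<bar> *\<^sub>R v k)"
  have xx: "x \<star> x \<le> 0"
    using abs_coeffs_lorentz_le[of K v b] neg b(2) unfolding x_def by fastforce
  define Z where "Z = {k \<in> K. b k = 0}"
  define z where "z = (\<Sum>k\<in>Z. v k)"
  have "\<exists>t>0. (x + t *\<^sub>R z) \<star> (x + t *\<^sub>R z) \<le> 0"
  proof (cases "Z = {}")
    case True
    then show ?thesis using xx by (intro exI[of _ 1]) (simp add: z_def)
  next
    case False
    have "x \<star> v k < 0" if "k \<in> Z" for k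
    proof -
      have "(\<Sum>l\<in>K. \<bar>b l\<bar> * (v l \<star> v k)) < 0"
        using fin b(1) neg that by (intro weighted_sum_neg) (auto simp: Z_def)
      then show ?thesis by (simp add: x_def lorentz.sum_left lorentz_simps)
    qed
    then have xz: "x \<star> z < 0"
      using False fin unfolding z_def lorentz.sum_right
      by (intro sum_strict_mono[of Z _ "\<lambda>_. 0", simplified]) (auto simp: Z_def)
    have "\<not> (\<forall>t. 0 < t \<longrightarrow> t \<le> 1 \<longrightarrow> 0 \<le> 2 * (x \<star> z) * t + (z \<star> z) * t\<^sup>2)"
      using linear_coeff_nonneg[of "2 * (x \<star> z)" "z \<star> z"] xz by auto
    then obtain t where t: "0 < t" "2 * (x \<star> z) * t + (z \<star> z) * t\<^sup>2 < 0" by auto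
    then have "(x + t *\<^sub>R z) \<star> (x + t *\<^sub>R z) \<le> 0"
      using xx by (simp add: lorentz_simps lorentz_commute[of z x] power2_eq_square algebra_simps)
    then show ?thesis using t by blast
  qed
  then obtain t where t: "0 < t" "(x + t *\<^sub>R z) \<star> (x + t *\<^sub>R z) \<le> 0" by blast
  define c where "c k = (if k \<in> Z then t else \<bar>b k\<bar>)" for k
  have c: "0 < c k" if "k \<in> K" for k using that t by (auto simp: c_def Z_def)
  have "x + t *\<^sub>R z = (\<Sum>k\<in>K. \<bar>b k\<bar> *\<^sub>R v k + (if k \<in> Z then t *\<^sub>R v k else 0))"
    using fin by (simp add: x_def z_def Z_def sum.distrib scaleR_sum_right flip: sum.inter_filter)
  also have "\<dots> = (\<Sum>k\<in>K. c k *\<^sub>R v k)"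
    by (intro sum.cong) (auto simp: c_def Z_def)
  finally have xz: "x + t *\<^sub>R z = (\<Sum>k\<in>K. c k *\<^sub>R v k)" .
  define s where "s = sum c K"
  have s: "0 < s" using c fin b(1) unfolding s_def by (intro sum_pos) auto
  have "(\<Sum>k\<in>K. (c k / s) *\<^sub>R v k) = (1 / s) *\<^sub>R (x + t *\<^sub>R z)"
    unfolding xz scaleR_sum_right by simp
  then have "(\<Sum>k\<in>K. (c k / s) *\<^sub>R v k) \<star> (\<Sum>k\<in>K. (c k / s) *\<^sub>R v k) \<le> 0"
    using t s by (simp add: lorentz.scaleR_left lorentz.scaleR_right divide_le_0_iff)
  then show thesis using c s that[of "\<lambda>k. c k / s"] by (simp add: s_def flip: sum_divide_distrib)
qed

section \<open>Dual families and isometries\<close>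

lemma dual_family_independent:
  fixes u w :: "'i \<Rightarrow> 'n::finite lorentz"
  assumes "finite K"
    and off: "\<And>k l. k \<in> K \<Longrightarrow> l \<in> K \<Longrightarrow> k \<noteq> l \<Longrightarrow> u k \<star> w l = 0"
    and diag: "\<And>k. k \<in> K \<Longrightarrow> u k \<star> w k \<noteq> 0"
  shows "inj_on w K" "independent (w ` K)"
proof -
  show inj: "inj_on w K" using off diag by (metis inj_onI)
  have "c (w k) = 0" if "(\<Sum>x\<in>w ` K. c x *\<^sub>R x) = 0" "k \<in> K" for c k
  proof -
    have "0 = u k \<star> (\<Sum>l\<in>K. c (w l) *\<^sub>R w l)"
      using that(1) by (simp add: sum.reindex[OF inj] lorentz.zero_right)
    also have "\<dots> = (\<Sum>l\<in>K. if l = k then c (w k) * (u k \<star> w k) else 0)"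
      unfolding lorentz.sum_right lorentz_simps using off that by (intro sum.cong) auto
    finally show ?thesis using that diag \<open>finite K\<close> by simp
  qed
  then show "independent (w ` K)" using \<open>finite K\<close> by (subst dependent_finite) auto
qed

text \<open>
  \<open>CARD('n) + 1\<close> is the dimension of Lorentzian space, so a family with a dual family of this size is
  a basis, and the dual family reads off the coordinates.
\<close>

lemma dual_family_expansion:
  fixes u w :: "'i \<Rightarrow> 'n::finite lorentz"
  assumes card: "card K = CARD('n) + 1"
    and off: "\<And>k l. k \<in> K \<Longrightarrow> l \<in> K \<Longrightarrow> k \<noteq> l \<Longrightarrow> u k \<star> w l = 0"
    and diag: "\<And>k. k \<in> K \<Longrightarrow> u k \<star> w k \<noteq> 0"
  shows "y = (\<Sum>k\<in>K. ((u k \<star> y) / (u k \<star> w k)) *\<^sub>R w k)"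
proof -
  have fin: "finite K" using card by (metis card.infinite add_is_0 one_neq_zero)
  note ind = dual_family_independent[OF fin off diag]
  have "UNIV \<subseteq> span (w ` K)"
    using ind card by (intro card_ge_dim_independent) (auto simp: card_image dim_UNIV)
  then have "y \<in> span (w ` K)" by auto
  then obtain c where y: "y = (\<Sum>l\<in>K. c l *\<^sub>R w l)"
    using fin by (auto simp: span_finite sum.reindex[OF ind(1)])
  have "u k \<star> y = c k * (u k \<star> w k)" if k: "k \<in> K" for k
  proof -
    have "u k \<star> y = (\<Sum>l\<in>K. if l = k then c k * (u k \<star> w k) else 0)"
      unfolding y lorentz.sum_right lorentz_simps using off k by (intro sum.cong) auto
    then show ?thesis using fin k by simp
  qed
  then show ?thesis unfolding y using diag by (intro sum.cong) auto
qed

lemma orthogonal_to_basis_eq_0: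
  fixes w :: "'i \<Rightarrow> 'n::finite lorentz"
  assumes "card K = CARD('n) + 1" "finite K" "inj_on w K" "independent (w ` K)"
    and "\<And>k. k \<in> K \<Longrightarrow> x \<star> w k = 0"
  shows "x = 0"
proof (rule lorentz_nondegenerate)
  fix y
  have "UNIV \<subseteq> span (w ` K)"
    using assms by (intro card_ge_dim_independent) (auto simp: card_image dim_UNIV)
  then have "y \<in> span (w ` K)" by auto
  then obtain c where y: "y = (\<Sum>l\<in>K. c l *\<^sub>R w l)"
    using assms by (auto simp: span_finite sum.reindex)
  show "x \<star> y = 0" unfolding y lorentz.sum_right lorentz_simps using assms by simp
qed

lemma independent_if_affine_independent_proj_plane:
  assumes "finite S" "S \<subseteq> (proj_plane :: 'n::finite lorentz set)" "\<not> affine_dependent S"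
  shows "independent S"
proof
  assume "dependent S"
  then obtain c x where c: "x \<in> S" "c x \<noteq> 0" "(\<Sum>x\<in>S. c x *\<^sub>R x) = 0"
    using assms(1) by (auto simp: dependent_finite)
  have "0 = fst (\<Sum>x\<in>S. c x *\<^sub>R x)" using c by simp
  also have "\<dots> = (\<Sum>x\<in>S. c x * fst x)" by (simp add: fst_sum)
  also have "\<dots> = sum c S" using assms(2) by (intro sum.cong) (auto simp: proj_plane_def)
  finally show False using assms c affine_dependent_explicit_finite[OF assms(1)] by auto
qed

text \<open>
  The reflection in the hyperplane orthogonal to \<open>z = x - e\<close>, where \<open>e\<close> is the multiple of the origin
  with the same Lorentz norm as \<open>x\<close>. It exists because \<open>z\<close> is not lightlike unless it vanishes.
\<close>

lemma exists_lorentz_isometry: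
  fixes x :: "'n::finite lorentz"
  assumes "x \<star> x < 0"
  obtains R :: "'n lorentz \<Rightarrow> 'n lorentz"
  where "linear R" "\<And>y z. R y \<star> R z = y \<star> z" "R x = sqrt (- (x \<star> x)) *\<^sub>R proj_origin"
proof -
  define r where "r = sqrt (- (x \<star> x))"
  have r: "r\<^sup>2 = - (x \<star> x)" "0 < r" using assms by (simp_all add: r_def)
  define e :: "'n lorentz" where "e = r *\<^sub>R proj_origin"
  have ee: "e \<star> e = x \<star> x" using r
    by (simp add: e_def lorentz_inner_def proj_origin_def power2_eq_square)
  define z where "z = x - e"
  show thesis
  proof (cases "z = 0")
    case True
    then show ?thesis using that[of id] by (simp add: z_def e_def r_def linear_id)
  next
    case False
    have zz: "z \<star> z = 2 * (x \<star> z)" "e \<star> z = - (x \<star> z)"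
      using ee by (simp_all add: z_def lorentz_simps lorentz_commute[of e x])
    \<comment> \<open>If \<open>z\<close> were lightlike, it would be orthogonal to \<open>e\<close>, hence have first coordinate \<open>0\<close> and be
        spacelike.\<close>
    have "x \<star> z \<noteq> 0"
    proof
      assume "x \<star> z = 0"
      then have "fst z = 0" using zz r by (simp add: e_def lorentz_simps)
      then show False using lorentz_spacelike_if_fst_0(2)[of z] False zz \<open>x \<star> z = 0\<close> by simp
    qed
    then have nz: "z \<star> z \<noteq> 0" using zz by simp
    define R where "R y = y - (2 * (y \<star> z) / (z \<star> z)) *\<^sub>R z" for y
    have "linear R" by (rule linearI) (simp_all add: R_def lorentz_simps algebra_simps add_divide_distrib)
    moreover have "R y \<star> R y' = y \<star> y'" for y y'
    proof -
      have "R y \<star> R y' = y \<star> y' - 2 * (y' \<star> z) / (z \<star> z) * (y \<star> z)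
          - 2 * (y \<star> z) / (z \<star> z) * (z \<star> y')
          + 2 * (y \<star> z) / (z \<star> z) * (2 * (y' \<star> z) / (z \<star> z)) * (z \<star> z)"
        by (simp add: R_def lorentz_simps algebra_simps)
      also have "\<dots> = y \<star> y'" unfolding lorentz_commute[of z y'] using nz by (simp add: field_simps)
      finally show ?thesis .
    qed
    moreover have "R x = e" using zz \<open>x \<star> z \<noteq> 0\<close> by (simp add: R_def) (simp add: z_def)
    ultimately show ?thesis using that by (simp add: e_def r_def)
  qed
qed

section \<open>Gram matrices of Lorentzian vectors\<close>

lemma gram_matrix_carrier [simp]: "gram_matrix n \<theta> \<in> carrier_mat (Suc n) (Suc n)"
  by (simp add: gram_matrix_def)

text \<open>
  The Gram matrix of the family dual to \<open>u\<close>, here \<open>H\<close>, is the inverse of the Gram matrix of \<open>u\<close>; the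
  scaling by \<open>u i \<star> v i\<close> accounts for \<open>v\<close> being dual only up to factors. Cofactors are the entries of
  \<open>det G * H\<close>.
\<close>

lemma gram_cofactor_eq:
  fixes u v :: "nat \<Rightarrow> 'n::finite lorentz"
  assumes n: "n = CARD('n)"
    and gram: "\<And>i j. i \<in> {1..n+1} \<Longrightarrow> j \<in> {1..n+1} \<Longrightarrow> u i \<star> u j = - cos (\<theta> i j)"
    and off: "\<And>i j. i \<in> {1..n+1} \<Longrightarrow> j \<in> {1..n+1} \<Longrightarrow> i \<noteq> j \<Longrightarrow> u i \<star> v j = 0"
    and diag: "\<And>i. i \<in> {1..n+1} \<Longrightarrow> u i \<star> v i \<noteq> 0"
  defines "G \<equiv> gram_matrix n \<theta>"
  shows "Determinant.det G \<noteq> 0"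
    and "i \<in> {1..n+1} \<Longrightarrow> j \<in> {1..n+1} \<Longrightarrow>
      gram_cofactor n \<theta> i j = Determinant.det G * ((v i \<star> v j) / ((u i \<star> v i) * (u j \<star> v j)))"
proof -
  define N where "N = n + 1"
  define h where "h i j = (v i \<star> v j) / ((u i \<star> v i) * (u j \<star> v j))" for i j
  define H where "H = Matrix.mat N N (\<lambda>(i, j). h (i + 1) (j + 1))"
  have G: "G \<in> carrier_mat N N" and H: "H \<in> carrier_mat N N"
    by (simp_all add: G_def N_def H_def)
  have GH: "G * H = 1\<^sub>m N"
  proof (rule eq_matI)
    fix i j assume "i < dim_row (1\<^sub>m N)" "j < dim_col (1\<^sub>m N)"
    then have ij: "i < N" "j < N" "i + 1 \<in> {1..n+1}" "j + 1 \<in> {1..n+1}" by (simp_all add: N_def)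
    have "(G * H) $$ (i, j) = (\<Sum>k<N. (u (i + 1) \<star> u (k + 1)) * h (k + 1) (j + 1))"
      using ij gram by (simp add: G_def H_def gram_matrix_def scalar_prod_def lessThan_atLeast0 N_def)
    also have "\<dots> = (\<Sum>k=1..N. (u (i + 1) \<star> u k) * h k (j + 1))"
      by (simp add: sum.atLeast1_atMost_eq)
    also have "\<dots> = (\<Sum>k=1..N. (v k \<star> v (j + 1)) / (v k \<star> u k) * (u (i + 1) \<star> u k)) / (u (j + 1) \<star> v (j + 1))"
      by (simp add: h_def sum_divide_distrib lorentz_commute[of "u _" "v _"] mult.commute)
    also have "(\<Sum>k=1..N. (v k \<star> v (j + 1)) / (v k \<star> u k) * (u (i + 1) \<star> u k)) = u (i + 1) \<star> v (j + 1)"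
    proof -
      have "v (j + 1) = (\<Sum>k=1..N. ((v k \<star> v (j + 1)) / (v k \<star> u k)) *\<^sub>R u k)"
        using off diag n by (intro dual_family_expansion) (simp_all add: N_def lorentz_commute[of "v _" "u _"])
      then have "u (i + 1) \<star> v (j + 1) = u (i + 1) \<star> (\<Sum>k=1..N. ((v k \<star> v (j + 1)) / (v k \<star> u k)) *\<^sub>R u k)"
        by simp
      then show ?thesis unfolding lorentz.sum_right lorentz.scaleR_right by simp
    qed
    finally show "(G * H) $$ (i, j) = 1\<^sub>m N $$ (i, j)"
      using off[of "i + 1" "j + 1"] diag[of "j + 1"] ij by auto
  qed (simp_all add: G_def H_def gram_matrix_def N_def)
  then have "Determinant.det G * Determinant.det H = 1" using det_mult[OF G H] by simp
  then show "Determinant.det G \<noteq> 0" by auto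
  note adj = adj_mat[OF G]
  have "adj_mat G = adj_mat G * (G * H)" using adj(1) by (simp add: GH)
  also have "\<dots> = Determinant.det G \<cdot>\<^sub>m 1\<^sub>m N * H"
    using adj G H by (simp flip: assoc_mult_mat[of _ N N _ N _ N])
  also have "\<dots> = Determinant.det G \<cdot>\<^sub>m H"
    using mult_smult_assoc_mat[OF one_carrier_mat H] H by simp
  finally have A: "adj_mat G = Determinant.det G \<cdot>\<^sub>m H" .
  show "gram_cofactor n \<theta> i j = Determinant.det G * ((v i \<star> v j) / ((u i \<star> v i) * (u j \<star> v j)))"
    if ij: "i \<in> {1..n+1}" "j \<in> {1..n+1}"
  proof -
    obtain i' j' where ij': "i = Suc i'" "j = Suc j'" "i' < N" "j' < N"
      using ij by (cases i; cases j) (auto simp: N_def)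
    have "gram_cofactor n \<theta> i j = adj_mat G $$ (j', i')"
      using ij' G by (simp add: gram_cofactor_def adj_mat_def cofactor_def G_def)
    also have "\<dots> = Determinant.det G * h j i" using ij' H by (simp add: A) (simp add: H_def)
    finally show ?thesis by (simp add: h_def lorentz_commute[of "v i"] mult.commute)
  qed
qed

text \<open>
  Sylvester's law of inertia in this instance: the eigenvectors of the Gram matrix, used as
  coefficients, give pairwise Lorentz-orthogonal vectors \<open>y k\<close> whose squares are the eigenvalues. If
  all were positive, the form would be positive definite. If two were negative, some combination of
  the two vectors would have first coordinate \<open>0\<close> without being spacelike. The determinant is the
  product of the eigenvalues, exactly one of which is negative.
\<close>

lemma gram_signature:
  fixes u :: "nat \<Rightarrow> 'n::finite lorentz"
  assumes n: "n = CARD('n)"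
    and gram: "\<And>i j. i \<in> {1..n+1} \<Longrightarrow> j \<in> {1..n+1} \<Longrightarrow> u i \<star> u j = - cos (\<theta> i j)"
    and det: "Determinant.det (gram_matrix n \<theta>) \<noteq> 0"
  shows "matrix_signature (gram_matrix n \<theta>) = (n, 1)" "Determinant.det (gram_matrix n \<theta>) < 0"
proof -
  define N where "N = n + 1"
  define G where "G = gram_matrix n \<theta>"
  have G: "G \<in> carrier_mat N N" by (simp add: G_def N_def)
  have Gij: "G $$ (i, j) = u (i + 1) \<star> u (j + 1)" if "i < N" "j < N" for i j
    using that gram by (simp add: G_def gram_matrix_def N_def)
  have "G\<^sup>T = G" by (rule eq_matI) (use G in \<open>auto simp: Gij lorentz_commute\<close>)
  moreover have N: "N = CARD('n option)" by (simp add: N_def n card_option)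
  ultimately obtain Q d where Q: "Q \<in> carrier_mat N N" "Q\<^sup>T * Q = 1\<^sub>m N"
    and GQ: "G = Q * mat_diag N d * Q\<^sup>T"
    using symmetric_mat_diagonalization[where 'k = "'n option", of G] G by metis
  note dims = Q(1) mat_diag_dim[of N d] G
  have detG: "Determinant.det G = (\<Prod>k<N. d k)" by (rule det_diagonalization[OF Q GQ])
  then have d0: "d k \<noteq> 0" if "k < N" for k using det that by (auto simp: G_def)
  have "Q\<^sup>T * G * Q = (Q\<^sup>T * Q) * mat_diag N d * (Q\<^sup>T * Q)"
    unfolding GQ using dims by (simp add: assoc_mult_mat[of _ N N _ N _ N] mult_carrier_mat[of _ N N])
  also have "\<dots> = mat_diag N d"
    by (simp add: Q(2) left_mult_one_mat[OF mat_diag_dim] right_mult_one_mat[OF mat_diag_dim])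
  finally have QGQ: "Q\<^sup>T * G * Q = mat_diag N d" .
  define y where "y k = (\<Sum>i<N. Q $$ (i, k) *\<^sub>R u (i + 1))" for k
  have yy: "y k \<star> y l = (if k = l then d k else 0)" if "k < N" "l < N" for k l
  proof -
    have "y k \<star> y l = (\<Sum>j<N. (\<Sum>i<N. Q $$ (i, k) * G $$ (i, j)) * Q $$ (j, l))"
      unfolding y_def lorentz.sum_right by (intro sum.cong refl)
        (simp add: lorentz.sum_left lorentz_simps Gij sum_distrib_left ac_simps)
    also have "\<dots> = (Q\<^sup>T * G * Q) $$ (k, l)"
      using that dims by (simp add: scalar_prod_def lessThan_atLeast0 del: assoc_mult_mat)
    finally show ?thesis using that by (simp add: QGQ mat_diag_def)
  qed
  have "\<exists>k<N. d k < 0"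
  proof (rule ccontr)
    assume "\<not> (\<exists>k<N. d k < 0)"
    then have pos: "0 < d k" if "k < N" for k using d0 that by force
    define c where "c k = (y k \<star> proj_origin) / d k" for k
    have "(proj_origin :: 'n lorentz) = (\<Sum>k<N. c k *\<^sub>R y k)"
    proof -
      have "(proj_origin :: 'n lorentz) = (\<Sum>k<N. ((y k \<star> proj_origin) / (y k \<star> y k)) *\<^sub>R y k)"
        using yy d0 by (intro dual_family_expansion) (auto simp: N_def n)
      also have "\<dots> = (\<Sum>k<N. c k *\<^sub>R y k)" using yy by (intro sum.cong) (simp_all add: c_def)
      finally show ?thesis .
    qed
    then have "(proj_origin :: 'n lorentz) \<star> proj_origin = (\<Sum>k<N. \<Sum>l<N. c k * c l * (y k \<star> y l))"
      using lorentz_sum_self[of c y "{..<N}"] by simp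
    also have "\<dots> \<ge> 0"
      using pos by (intro sum_nonneg) (auto simp: yy less_imp_le)
    finally show False by (simp add: proj_origin_def lorentz_inner_def)
  qed
  then obtain k0 where k0: "k0 < N" "d k0 < 0" by blast
  have pos: "0 < d l" if l: "l < N" "l \<noteq> k0" for l
  proof (rule ccontr)
    assume "\<not> 0 < d l"
    then have dl: "d l < 0" using d0[OF l(1)] by simp
    define z where "z = fst (y l) *\<^sub>R y k0 - fst (y k0) *\<^sub>R y l"
    have "0 \<le> z \<star> z" by (rule lorentz_spacelike_if_fst_0) (simp add: z_def)
    moreover have "z \<star> z = (fst (y l))\<^sup>2 * d k0 + (fst (y k0))\<^sup>2 * d l"
      using k0 l by (simp add: z_def lorentz_simps yy power2_eq_square)
    moreover have "(fst (y l))\<^sup>2 * d k0 \<le> 0" "(fst (y k0))\<^sup>2 * d l \<le> 0"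
      using k0 dl by (auto simp: mult_nonneg_nonpos)
    ultimately have "(fst (y k0))\<^sup>2 * d l = 0" by linarith
    then have "0 \<le> y k0 \<star> y k0" using dl by (intro lorentz_spacelike_if_fst_0) auto
    then show False using k0 yy by simp
  qed
  have neg: "{k. k < N \<and> d k < 0} = {k0}" "{k. k < N \<and> 0 < d k} = {..<N} - {k0}"
    using k0 pos by (auto, (metis less_asym)+)
  show "matrix_signature (gram_matrix n \<theta>) = (n, 1)"
    using matrix_signature_diagonalization[OF Q GQ] k0 unfolding neg by (simp add: G_def N_def)
  have "Determinant.det G = d k0 * (\<Prod>k\<in>{..<N} - {k0}. d k)"
    using k0 by (simp add: detG prod.remove)
  also have "\<dots> < 0" using k0 pos by (intro mult_neg_pos prod_pos) auto
  finally show "Determinant.det (gram_matrix n \<theta>) < 0" by (simp add: G_def)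
qed

text \<open>
  The coefficients of the dual family are the columns of the inverse of the Gram matrix, written with
  the adjugate. The sign \<open>-1\<close> makes \<open>u i\<close> an outward normal of the facet opposite to \<open>w i\<close>.
\<close>

lemma exists_dual_family:
  fixes u :: "nat \<Rightarrow> 'n::finite lorentz"
  assumes gram: "\<And>i j. i \<in> {1..n+1} \<Longrightarrow> j \<in> {1..n+1} \<Longrightarrow> u i \<star> u j = - cos (\<theta> i j)"
    and det: "Determinant.det (gram_matrix n \<theta>) \<noteq> 0"
  obtains w :: "nat \<Rightarrow> 'n lorentz"
  where "\<And>i j. i \<in> {1..n+1} \<Longrightarrow> j \<in> {1..n+1} \<Longrightarrow> i \<noteq> j \<Longrightarrow> u i \<star> w j = 0"
    and "\<And>i. i \<in> {1..n+1} \<Longrightarrow> u i \<star> w i = -1"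
proof -
  define N where "N = n + 1"
  define G where "G = gram_matrix n \<theta>"
  have G: "G \<in> carrier_mat N N" by (simp add: G_def N_def)
  note adj = adj_mat[OF G]
  define w where "w j = (- 1 / Determinant.det G) *\<^sub>R (\<Sum>k<N. adj_mat G $$ (k, j - 1) *\<^sub>R u (k + 1))" for j
  have uw: "u i \<star> w j = (if i = j then -1 else 0)" if ij: "i \<in> {1..n+1}" "j \<in> {1..n+1}" for i j
  proof -
    have ij': "i - 1 < N" "j - 1 < N" "i - 1 + 1 = i" using ij by (auto simp: N_def)
    have "(\<Sum>k<N. G $$ (i - 1, k) * adj_mat G $$ (k, j - 1)) = (G * adj_mat G) $$ (i - 1, j - 1)"
      using ij' G adj(1) by (simp add: scalar_prod_def lessThan_atLeast0)
    also have "\<dots> = (if i = j then Determinant.det G else 0)"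
      using ij' ij by (auto simp: adj(2))
    moreover have "G $$ (i - 1, k) = u i \<star> u (k + 1)" if "k < N" for k
      using that ij ij' gram[of i "k + 1"] by (simp add: G_def gram_matrix_def N_def)
    ultimately have "(\<Sum>k<N. (u i \<star> u (k + 1)) * adj_mat G $$ (k, j - 1)) = (if i = j then Determinant.det G else 0)"
      by simp
    then show ?thesis using det
      by (simp add: w_def G_def lorentz.scaleR_right lorentz.sum_right lorentz.minus_right mult.commute)
  qed
  show thesis by (rule that[of w]) (auto simp: uw)
qed

text \<open>
  In the diagonalization \<open>G = Q D Q\<^sup>T\<close> the rows of \<open>Q\<close>, with the entry in column \<open>k\<close> scaled by
  \<open>sqrt \<bar>d k\<bar>\<close>, have \<open>G\<close> as Gram matrix for the form with signs \<open>sgn (d k)\<close>. The one negative entry becomes the time coordinate and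
  the positive ones are numbered by \<open>'n\<close>.
\<close>

lemma exists_gram_realization:
  assumes n: "n = CARD('n)"
    and sym: "\<And>i j. i \<in> {1..n+1} \<Longrightarrow> j \<in> {1..n+1} \<Longrightarrow> \<theta> i j = \<theta> j i"
    and sig: "matrix_signature (gram_matrix n \<theta>) = (n, 1)"
  obtains u :: "nat \<Rightarrow> 'n::finite lorentz" where
    "\<And>i j. i \<in> {1..n+1} \<Longrightarrow> j \<in> {1..n+1} \<Longrightarrow> u i \<star> u j = - cos (\<theta> i j)"
    and "Determinant.det (gram_matrix n \<theta>) \<noteq> 0"
proof -
  define N where "N = n + 1"
  define G where "G = gram_matrix n \<theta>"
  have G: "G \<in> carrier_mat N N" by (simp add: G_def N_def)
  have Gij: "G $$ (i, j) = - cos (\<theta> (i + 1) (j + 1))" if "i < N" "j < N" for i j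
    using that by (simp add: G_def gram_matrix_def N_def)
  have "G\<^sup>T = G" by (rule eq_matI) (use G sym in \<open>auto simp: Gij N_def\<close>)
  moreover have N: "N = CARD('n option)" by (simp add: N_def n card_option)
  ultimately obtain Q d where Q: "Q \<in> carrier_mat N N" "Q\<^sup>T * Q = 1\<^sub>m N"
    and GQ: "G = Q * mat_diag N d * Q\<^sup>T"
    using symmetric_mat_diagonalization[where 'k = "'n option", of G] G by metis
  define Pos where "Pos = {k. k < N \<and> 0 < d k}"
  define Neg where "Neg = {k. k < N \<and> d k < 0}"
  have cards: "card Pos = n" "card Neg = 1"
    using matrix_signature_diagonalization[OF Q GQ] sig by (simp_all add: G_def Pos_def Neg_def)
  have fin: "finite Pos" "finite Neg" by (simp_all add: Pos_def Neg_def)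
  have disj: "Pos \<inter> Neg = {}" by (auto simp: Pos_def Neg_def)
  have "card (Pos \<union> Neg) = N" using cards fin disj by (simp add: card_Un_disjoint N_def)
  then have cover: "Pos \<union> Neg = {..<N}"
    by (intro card_subset_eq) (auto simp: Pos_def Neg_def)
  obtain k0 where k0: "Neg = {k0}" using cards(2) by (auto simp: card_1_singleton_iff)
  have dk0: "d k0 < 0" using k0 by (auto simp: Neg_def)
  obtain f :: "'n \<Rightarrow> nat" where f: "bij_betw f UNIV Pos"
    using finite_same_card_bij[of "UNIV :: 'n set" Pos] fin cards n by auto
  have fpos: "0 < d (f m)" for m using f by (auto simp: bij_betw_def Pos_def)
  define u :: "nat \<Rightarrow> 'n lorentz" where
    "u i = (sqrt (- d k0) * Q $$ (i - 1, k0), \<chi> m. sqrt (d (f m)) * Q $$ (i - 1, f m))" for i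
  have "u i \<star> u j = - cos (\<theta> i j)" if ij: "i \<in> {1..n+1}" "j \<in> {1..n+1}" for i j
  proof -
    let ?g = "\<lambda>k. Q $$ (i - 1, k) * d k * Q $$ (j - 1, k)"
    have neg: "sqrt (- d k0) * q * (sqrt (- d k0) * r) = - (q * d k0 * r)" for q r
      using dk0 by (simp add: ac_simps flip: mult.assoc[of "sqrt _" "sqrt _"])
    have pos: "sqrt (d (f m)) * q * (sqrt (d (f m)) * r) = q * d (f m) * r" for q r m
      using fpos[of m] by (simp add: ac_simps flip: mult.assoc[of "sqrt _" "sqrt _"])
    have "u i \<star> u j = ?g k0 + (\<Sum>m\<in>UNIV. ?g (f m))"
      by (simp add: lorentz_inner_def u_def inner_vec_def neg pos)
    also have "(\<Sum>m\<in>UNIV. ?g (f m)) = sum ?g Pos" by (rule sum.reindex_bij_betw[OF f])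
    also have "?g k0 + sum ?g Pos = sum ?g {..<N}"
      using fin disj unfolding cover[symmetric] by (simp add: sum.union_disjoint k0)
    also have "\<dots> = G $$ (i - 1, j - 1)"
    proof -
      have "i - 1 < N" "j - 1 < N" using ij by (auto simp: N_def)
      then show ?thesis unfolding GQ mat_diag_mult_right[OF Q(1)]
        using Q(1) by (simp add: scalar_prod_def lessThan_atLeast0)
    qed
    also have "\<dots> = - cos (\<theta> i j)" using ij by (subst Gij) (auto simp: N_def)
    finally show ?thesis .
  qed
  moreover have "Determinant.det G \<noteq> 0"
  proof -
    have "d k \<noteq> 0" if "k < N" for k
    proof -
      have "k \<in> Pos \<union> Neg" using that cover by simp
      then show ?thesis by (auto simp: Pos_def Neg_def)
    qed
    then show ?thesis by (simp add: det_diagonalization[OF Q GQ])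
  qed
  ultimately show thesis using that unfolding G_def by blast
qed

section \<open>The Gram matrix of a generalized simplex\<close>

lemma lorentz_hull_less:
  assumes "\<And>s. s \<in> S \<Longrightarrow> s \<star> z < 0" "x \<in> convex hull S"
  shows "x \<star> z < 0"
proof -
  have "convex hull S \<subseteq> {x. x \<star> z < 0}"
    using assms(1) by (intro hull_minimal convexI) (auto simp: lorentz_simps convex_bound_lt)
  then show ?thesis using assms(2) by auto
qed

lemma lorentz_hull_le:
  assumes "\<And>s. s \<in> S \<Longrightarrow> s \<star> z \<le> 0" "x \<in> convex hull S"
  shows "x \<star> z \<le> 0"
proof -
  have "convex hull S \<subseteq> {x. x \<star> z \<le> 0}"
    using assms(1) by (intro hull_minimal convexI) (auto simp: lorentz_simps convex_bound_le)
  then show ?thesis using assms(2) by auto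
qed

lemma lorentz_hull_eq_0:
  assumes "\<And>s. s \<in> S \<Longrightarrow> s \<star> z = 0" "x \<in> convex hull S"
  shows "x \<star> z = 0"
  using lorentz_hull_le[of S z x] lorentz_hull_le[of S "- z" x] assms by (auto simp: lorentz_simps)

lemma convex_proj_plane: "convex proj_plane"
  by (rule convexI) (simp add: proj_plane_def)

text \<open>
  Starting at a point where a product is negative, one can move a little towards any other point.
\<close>

lemma exists_negative_convex_combination:
  fixes p q :: real
  assumes "p < 0"
  obtains t where "0 < t" "t < 1" "(1 - t) * p + t * q < 0"
proof -
  have "\<not> (\<forall>t. 0 < t \<longrightarrow> t \<le> 1 \<longrightarrow> 0 \<le> p * t + (q - p) * t\<^sup>2)"
    using linear_coeff_nonneg[of p "q - p"] assms by auto
  then obtain t where t: "0 < t" "t \<le> 1" "p * t + (q - p) * t\<^sup>2 < 0" by auto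
  then have "t * (p + (q - p) * t) < 0" by (simp add: power2_eq_square algebra_simps)
  then have "p + (q - p) * t < 0" using t by (simp add: mult_less_0_iff)
  then have "(1 - t / 2) * p + t / 2 * q < 0" using assms by (simp add: field_simps)
  then show thesis using that[of "t / 2"] t by simp
qed

lemma simplex_indices_simps [simp]:
  "finite (simplex_indices TYPE('n::finite))" "card (simplex_indices TYPE('n)) = CARD('n) + 1"
  by (simp_all add: simplex_indices_def)

lemma spanned_simplex_subset_proj_plane:
  assumes "vertex_set v \<subseteq> proj_plane"
  shows "spanned_simplex v \<subseteq> proj_plane"
  unfolding spanned_simplex_def using assms by (intro hull_minimal convex_proj_plane)

lemma vertex_in_spanned_simplex:
  fixes v :: "nat \<Rightarrow> 'n::finite lorentz"
  shows "i \<in> simplex_indices TYPE('n) \<Longrightarrow> v i \<in> spanned_simplex v"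
  by (auto simp: spanned_simplex_def vertex_set_def intro: hull_inc)

text \<open>
  The pyramid without its base is the part of the simplex strictly on the side of \<open>w\<close>, so truncation
  amounts to imposing the inequalities \<open>x \<star> w \<le> 0\<close>.
\<close>

lemma truncated_simplex_eq:
  assumes v: "vertex_set v \<subseteq> proj_plane"
    and tr: "\<And>w. w \<in> vertex_set v \<inter> klein_exterior \<Longrightarrow> truncatable_at v w"
  shows "truncated_simplex v = {x \<in> spanned_simplex v. \<forall>w \<in> vertex_set v \<inter> klein_exterior. x \<star> w \<le> 0}"
proof -
  have "truncation_pyramid v w - truncation_base v w = {x \<in> spanned_simplex v. 0 < x \<star> w}"
    if w: "w \<in> vertex_set v \<inter> klein_exterior" for w
  proof -
    have "0 < w \<star> w" using w v klein_iff(3) by blast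
    then show ?thesis
      using tr[OF w] spanned_simplex_subset_proj_plane[OF v]
      by (auto simp: truncatable_at_def truncation_base_def polar_hyperplane_def unit_multiple_sign less_le)
  qed
  then have "truncated_simplex v =
      spanned_simplex v - (\<Union>w\<in>vertex_set v \<inter> klein_exterior. {x \<in> spanned_simplex v. 0 < x \<star> w})"
    by (simp add: truncated_simplex_def)
  also have "\<dots> = {x \<in> spanned_simplex v. \<forall>w \<in> vertex_set v \<inter> klein_exterior. x \<star> w \<le> 0}"
    unfolding not_less[symmetric] by blast
  finally show ?thesis .
qed

text \<open>
  The facts on which the whole passage to the Gram matrix rests, in a form common to ordinary
  and truncated simplices. A timelike point of a facet is the midpoint of two of its vertices if all
  vertices lie in the closed ball. For a truncated simplex it is found near a point \<open>x\<close> of a ridge in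
  the closed ball: \<open>x\<close> has negative product with the vertex that spans the facet together with the
  ridge, and moving towards this vertex decreases \<open>x \<star> x\<close>.
\<close>

lemma generalized_simplex_properties:
  fixes v :: "nat \<Rightarrow> 'n::finite lorentz"
  defines "I \<equiv> simplex_indices TYPE('n)"
  assumes gs: "generalized_simplex v P" and n: "CARD('n) \<ge> 2"
  shows "simplex_vertices v"
    and "P = {x \<in> spanned_simplex v. \<forall>w \<in> vertex_set v \<inter> klein_exterior. x \<star> w \<le> 0}"
    and "\<And>i j. i \<in> I \<Longrightarrow> j \<in> I \<Longrightarrow> i \<noteq> j \<Longrightarrow> v i \<star> v j < 0"
    and "\<And>i. i \<in> I \<Longrightarrow> \<exists>y \<in> facet_opposite v i. y \<star> y < 0"
proof -
  show sv: "simplex_vertices v"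
    using gs by (auto simp: generalized_simplex_def ordinary_simplex_def polar_truncated_simplex_def)
  then have plane: "vertex_set v \<subseteq> proj_plane" and inj: "inj_on v I"
    by (simp_all add: simplex_vertices_def I_def)
  have vI: "v i \<in> vertex_set v" if "i \<in> I" for i using that by (simp add: vertex_set_def I_def)
  then have vp: "v i \<in> proj_plane" if "i \<in> I" for i using plane that by blast
  have ne: "v i \<noteq> v j" if "i \<in> I" "j \<in> I" "i \<noteq> j" for i j using inj that by (auto simp: inj_on_def)
  have "P = {x \<in> spanned_simplex v. \<forall>w \<in> vertex_set v \<inter> klein_exterior. x \<star> w \<le> 0} \<and>
    (\<forall>i\<in>I. \<forall>j\<in>I. i \<noteq> j \<longrightarrow> v i \<star> v j < 0) \<and> (\<forall>i\<in>I. \<exists>y \<in> facet_opposite v i. y \<star> y < 0)"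
  proof (cases "ordinary_simplex v P")
    case True
    then have ball: "vertex_set v \<subseteq> klein_ball \<union> klein_sphere" and P: "P = spanned_simplex v"
      by (auto simp: ordinary_simplex_def)
    have "vertex_set v \<inter> klein_exterior = {}"
      using ball by (auto simp: klein_ball_def klein_sphere_def klein_exterior_def)
    moreover have le: "v i \<star> v i \<le> 0" if "i \<in> I" for i
      using ball klein_iff[OF vp[OF that]] vI[OF that] by auto
    moreover have neg: "v i \<star> v j < 0" if "i \<in> I" "j \<in> I" "i \<noteq> j" for i j
      using that by (intro lorentz_neg_closed_ball vp ne le)
    moreover have "\<exists>y \<in> facet_opposite v i. y \<star> y < 0" if i: "i \<in> I" for i
    proof -
      have "finite (I - {i})" "\<not> card (I - {i}) \<le> Suc 0" using n i by (simp_all add: I_def)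
      then obtain j k where jk: "j \<in> I - {i}" "k \<in> I - {i}" "j \<noteq> k"
        using card_le_Suc0_iff_eq[of "I - {i}"] by blast
      let ?y = "(1/2) *\<^sub>R v j + (1/2) *\<^sub>R v k"
      have "?y \<in> facet_opposite v i"
        unfolding facet_opposite_def using jk
        by (intro convexD[OF convex_convex_hull] hull_inc) (auto simp: I_def)
      moreover have "?y \<star> ?y < 0"
        using neg[of j k] le[of j] le[of k] jk
        by (simp add: lorentz_simps lorentz_commute[of "v k" "v j"] field_simps)
      ultimately show ?thesis by blast
    qed
    ultimately show ?thesis using P by auto
  next
    case False
    then have pt: "polar_truncated_simplex v P" using gs by (simp add: generalized_simplex_def)
    then have tr: "truncatable_at v w" if "w \<in> vertex_set v \<inter> klein_exterior" for w
      using that by (simp add: polar_truncated_simplex_def)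
    \<comment> \<open>The vertex \<open>v j\<close> lies in the simplex but not in the pyramid with apex \<open>v i\<close>, hence strictly on
      the other side of the polar hyperplane.\<close>
    have ext: "v j \<star> v i < 0" if ij: "i \<in> I" "j \<in> I" "i \<noteq> j" "0 < v i \<star> v i" for i j
    proof -
      have "v i \<in> vertex_set v \<inter> klein_exterior" using ij vI klein_iff(3)[OF vp] by simp
      from tr[OF this] have "truncation_pyramid v (v i) \<inter> vertex_set v = {v i}"
        and pyr: "truncation_pyramid v (v i) = {x \<in> spanned_simplex v. 0 \<le> x \<star> unit_multiple (v i)}"
        unfolding truncatable_at_def by blast+
      then have "v j \<notin> truncation_pyramid v (v i)" using ne[OF ij(1-3)] vI[OF ij(2)] by (metis Int_iff singletonD)
      then have "\<not> 0 \<le> v j \<star> unit_multiple (v i)"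
        using vertex_in_spanned_simplex[of j v] ij(2) by (simp add: pyr I_def)
      then show ?thesis using ij by (simp add: unit_multiple_sign)
    qed
    have neg: "v i \<star> v j < 0" if ij: "i \<in> I" "j \<in> I" "i \<noteq> j" for i j
    proof (cases "0 < v i \<star> v i \<or> 0 < v j \<star> v j")
      case True
      then show ?thesis using ext[of i j] ext[of j i] ij by (auto simp: lorentz_commute)
    next
      case False
      then show ?thesis using ij by (intro lorentz_neg_closed_ball vp ne) auto
    qed
    have "\<exists>y \<in> facet_opposite v i. y \<star> y < 0" if i: "i \<in> I" for i
    proof -
      have "card (I - {i}) \<noteq> 0" using n i by (simp add: I_def)
      then have "I - {i} \<noteq> {}" by (metis card.empty)
      then obtain k where k: "k \<in> I" "k \<noteq> i" by blast
      have "rel_interior (ridge_opposite v i k) \<inter> (klein_ball \<union> klein_sphere) \<noteq> {}"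
        using pt i k by (auto simp: polar_truncated_simplex_def ridges_meet_closed_ball_def I_def)
      then obtain x where x: "x \<in> ridge_opposite v i k" "x \<in> klein_ball \<union> klein_sphere"
        using rel_interior_subset by blast
      then have xx: "x \<star> x \<le> 0" using klein_iff[of x] by (auto simp: klein_ball_def klein_sphere_def)
      have xk: "x \<star> v k < 0"
      proof (rule lorentz_hull_less)
        show "x \<in> convex hull (v ` (I - {i, k}))" using x(1) by (simp add: ridge_opposite_def I_def)
        fix s assume "s \<in> v ` (I - {i, k})"
        then obtain l where "l \<in> I" "l \<noteq> k" "s = v l" by blast
        then show "s \<star> v k < 0" using neg k by simp
      qed
      have "ridge_opposite v i k \<subseteq> facet_opposite v i"
        unfolding ridge_opposite_def facet_opposite_def by (intro hull_mono) auto
      then have xf: "x \<in> facet_opposite v i" using x by blast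
      have vkf: "v k \<in> facet_opposite v i"
        using k by (auto simp: facet_opposite_def I_def intro: hull_inc)
      obtain t where t: "0 < t" "t < 1" "(1 - t) * (2 * (x \<star> v k)) + t * (v k \<star> v k) < 0"
        using exists_negative_convex_combination[of "2 * (x \<star> v k)" "v k \<star> v k"] xk by auto
      let ?y = "(1 - t) *\<^sub>R x + t *\<^sub>R v k"
      have "?y \<star> ?y = (1 - t)\<^sup>2 * (x \<star> x) + t * ((1 - t) * (2 * (x \<star> v k)) + t * (v k \<star> v k))"
        by (simp add: lorentz_simps lorentz_commute[of "v k" x] power2_eq_square algebra_simps)
      also have "\<dots> < 0"
        using mult_pos_neg[OF t(1,3)] mult_nonneg_nonpos[OF zero_le_power2[of "1 - t"] xx] by linarith
      finally have "?y \<star> ?y < 0" .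
      moreover have "?y \<in> facet_opposite v i"
        using xf vkf t unfolding facet_opposite_def by (intro convexD[OF convex_convex_hull]) auto
      ultimately show ?thesis by blast
    qed
    moreover have "P = truncated_simplex v" using pt by (simp add: polar_truncated_simplex_def)
    ultimately show ?thesis using truncated_simplex_eq[OF plane tr] neg by auto
  qed
  then show "P = {x \<in> spanned_simplex v. \<forall>w \<in> vertex_set v \<inter> klein_exterior. x \<star> w \<le> 0}"
    and "\<And>i j. i \<in> I \<Longrightarrow> j \<in> I \<Longrightarrow> i \<noteq> j \<Longrightarrow> v i \<star> v j < 0"
    and "\<And>i. i \<in> I \<Longrightarrow> \<exists>y \<in> facet_opposite v i. y \<star> y < 0" by blast+
qed

lemma simplex_vertices_independent:
  fixes v :: "nat \<Rightarrow> 'n::finite lorentz"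
  assumes "simplex_vertices v"
  shows "inj_on v (simplex_indices TYPE('n))" "independent (v ` simplex_indices TYPE('n))"
  using assms independent_if_affine_independent_proj_plane[of "vertex_set v"]
  by (simp_all add: simplex_vertices_def vertex_set_def)

lemma simplex_vertices_orthogonal_eq_0:
  fixes v :: "nat \<Rightarrow> 'n::finite lorentz"
  assumes "simplex_vertices v" "\<And>i. i \<in> simplex_indices TYPE('n) \<Longrightarrow> x \<star> v i = 0"
  shows "x = 0"
  using simplex_vertices_independent[OF assms(1)] assms(2)
  by (intro orthogonal_to_basis_eq_0[of "simplex_indices TYPE('n)" v]) auto

text \<open>
  Near a point \<open>x\<close> of the facet that has negative product with all vertices, no truncation is felt.
  From \<open>x\<close> one can therefore move a little towards each vertex without leaving the polyhedron; moving
  within the facet shows that \<open>u\<close> is orthogonal to its vertices, moving towards \<open>v i\<close> gives the sign.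
\<close>

lemma outward_unit_normal_vertices:
  fixes v :: "nat \<Rightarrow> 'n::finite lorentz"
  defines "I \<equiv> simplex_indices TYPE('n)"
  assumes gs: "generalized_simplex v P" and n: "CARD('n) \<ge> 2"
    and i: "i \<in> I" and u: "outward_unit_normal v P i u"
  shows "\<And>j. j \<in> I \<Longrightarrow> j \<noteq> i \<Longrightarrow> u \<star> v j = 0" and "u \<star> v i < 0"
proof -
  note props = generalized_simplex_properties[OF gs n]
  have neg: "v k \<star> v l < 0" if "k \<in> I" "l \<in> I" "k \<noteq> l" for k l
    using props(3) that by (simp add: I_def)
  have facet: "facet_opposite v i = convex hull (v ` (I - {i}))" by (simp add: facet_opposite_def I_def)
  obtain y where y: "y \<in> facet_opposite v i" "y \<star> y < 0" using props(4)[OF i[unfolded I_def]] by blast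
  obtain x where x: "x \<in> facet_opposite v i" "\<And>k. k \<in> I - {i} \<Longrightarrow> x \<star> v k < 0"
    using exists_hull_point_negative_on_vertices[of "I - {i}" v y] y neg
    unfolding facet by (metis Diff_iff I_def finite_Diff simplex_indices_simps(1))
  have "x \<star> v i < 0"
  proof (rule lorentz_hull_less)
    show "x \<in> convex hull (v ` (I - {i}))" using x(1) by (simp add: facet_opposite_def I_def)
    fix s assume "s \<in> v ` (I - {i})"
    then obtain k where "k \<in> I" "k \<noteq> i" "s = v k" by blast
    then show "s \<star> v i < 0" using neg i by simp
  qed
  then have xneg: "x \<star> v k < 0" if "k \<in> I" for k using x(2) that by (cases "k = i") auto
  have fs: "facet_opposite v i \<subseteq> spanned_simplex v"
    unfolding facet_opposite_def spanned_simplex_def vertex_set_def by (intro hull_mono) auto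
  have inP: "z \<in> P" if "z \<in> spanned_simplex v" "\<And>m. m \<in> I \<Longrightarrow> z \<star> v m < 0" for z
  proof -
    have "z \<star> w \<le> 0" if w: "w \<in> vertex_set v \<inter> klein_exterior" for w
    proof -
      obtain m where "m \<in> I" "w = v m" using w unfolding vertex_set_def I_def by blast
      then show ?thesis using \<open>\<And>m. m \<in> I \<Longrightarrow> z \<star> v m < 0\<close>[of m] by simp
    qed
    then show ?thesis using that(1) unfolding props(2) by simp
  qed
  have near: "\<exists>t. 0 < t \<and> t < 1 \<and> (1 - t) *\<^sub>R x + t *\<^sub>R v j \<in> P" if j: "j \<in> I" for j
  proof -
    obtain t where t: "0 < t" "t < 1" "(1 - t) * (x \<star> v j) + t * (v j \<star> v j) < 0"
      using exists_negative_convex_combination[OF xneg[OF j]] by blast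
    let ?z = "(1 - t) *\<^sub>R x + t *\<^sub>R v j"
    have "?z \<in> spanned_simplex v"
      using fs x(1) j t vertex_in_spanned_simplex[of j v] unfolding spanned_simplex_def
      by (intro convexD[OF convex_convex_hull]) (auto simp: I_def)
    moreover have "?z \<star> v m < 0" if m: "m \<in> I" for m
    proof (cases "m = j")
      case True
      then show ?thesis using t by (simp add: lorentz_simps)
    next
      case False
      then have "v j \<star> v m < 0" using neg j m by simp
      then have "(1 - t) * (x \<star> v m) + t * (v j \<star> v m) < 0"
        using xneg[OF m] t by (intro add_neg_neg mult_pos_neg) auto
      then show ?thesis by (simp add: lorentz_simps)
    qed
    ultimately have "?z \<in> P" by (rule inP)
    then show ?thesis using t by blast
  qed
  have "x \<in> P" using x(1) fs xneg by (intro inP) auto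
  then have ux: "u \<star> x = 0" using x u by (simp add: outward_unit_normal_def polyhedron_facet_def)
  show off: "u \<star> v j = 0" if j: "j \<in> I" "j \<noteq> i" for j
  proof -
    obtain t where t: "0 < t" "t < 1" "(1 - t) *\<^sub>R x + t *\<^sub>R v j \<in> P" using near j by blast
    moreover have "(1 - t) *\<^sub>R x + t *\<^sub>R v j \<in> facet_opposite v i"
      using x(1) j t unfolding facet_opposite_def
      by (intro convexD[OF convex_convex_hull]) (auto simp: I_def intro: hull_inc)
    ultimately have "u \<star> ((1 - t) *\<^sub>R x + t *\<^sub>R v j) = 0"
      using u by (simp add: outward_unit_normal_def polyhedron_facet_def)
    then show ?thesis using t ux by (simp add: lorentz_simps)
  qed
  have "u \<star> v i \<noteq> 0"
  proof
    assume "u \<star> v i = 0"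
    then have "u \<star> v k = 0" if "k \<in> I" for k using off that by (cases "k = i") simp_all
    then have "u = 0" unfolding I_def by (rule simplex_vertices_orthogonal_eq_0[OF props(1)])
    then show False using u by (simp add: outward_unit_normal_def lorentz.zero_left)
  qed
  moreover obtain t where "0 < t" "t < 1" "(1 - t) *\<^sub>R x + t *\<^sub>R v i \<in> P" using near i by blast
  then have "0 < t" "u \<star> ((1 - t) *\<^sub>R x + t *\<^sub>R v i) \<le> 0" using u by (auto simp: outward_unit_normal_def)
  then have "u \<star> v i \<le> 0" using ux by (simp add: lorentz_simps mult_le_0_iff)
  ultimately show "u \<star> v i < 0" by simp
qed

text \<open>
  Needed because \<open>has_dihedral_angle\<close> chooses normals anew for each pair of facets, while the Gram
  matrix requires one normal per facet.
\<close>

lemma outward_unit_normal_unique: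
  fixes v :: "nat \<Rightarrow> 'n::finite lorentz"
  assumes gs: "generalized_simplex v P" and n: "CARD('n) \<ge> 2"
    and i: "i \<in> simplex_indices TYPE('n)"
    and u: "outward_unit_normal v P i u" and u': "outward_unit_normal v P i u'"
  shows "u = u'"
proof -
  note props = generalized_simplex_properties[OF gs n]
  note un = outward_unit_normal_vertices[OF gs n i u] and un' = outward_unit_normal_vertices[OF gs n i u']
  define c where "c = (u \<star> v i) / (u' \<star> v i)"
  have c: "0 < c" using un un' by (simp add: c_def divide_neg_neg)
  have "(u - c *\<^sub>R u') \<star> v j = 0" if "j \<in> simplex_indices TYPE('n)" for j
    using that un un' by (cases "j = i") (auto simp: lorentz_simps c_def)
  then have "u - c *\<^sub>R u' = 0" by (rule simplex_vertices_orthogonal_eq_0[OF props(1)])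
  then have uc: "u = c *\<^sub>R u'" by simp
  then have "c * c = 1" using u u' by (simp add: outward_unit_normal_def lorentz_simps)
  then have "c = 1" using c by (simp add: square_eq_1_iff)
  then show ?thesis using uc by simp
qed

text \<open>
  The cofactor \<open>c\<^sub>i\<^sub>j\<close> is the product of the negative numbers \<open>det G\<close> and \<open>\<langle>v\<^sub>i, v\<^sub>j\<rangle>\<close>, divided by the
  product of the negative numbers \<open>\<langle>u\<^sub>i, v\<^sub>i\<rangle>\<close> and \<open>\<langle>u\<^sub>j, v\<^sub>j\<rangle>\<close>.
\<close>

lemma gram_conditions_of_generalized_simplex:
  fixes v :: "nat \<Rightarrow> 'n::finite lorentz"
  assumes n: "n = CARD('n)" and n2: "CARD('n) \<ge> 2"
    and gs: "generalized_simplex v P"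
    and dihedral: "\<And>i j. i \<in> {1..n+1} \<Longrightarrow> j \<in> {1..n+1} \<Longrightarrow> i \<noteq> j \<Longrightarrow> has_dihedral_angle v P i j (\<theta> i j)"
    and pi_iff: "\<And>i j. i \<in> {1..n+1} \<Longrightarrow> j \<in> {1..n+1} \<Longrightarrow> \<theta> i j = pi \<longleftrightarrow> i = j"
  shows "matrix_signature (gram_matrix n \<theta>) = (n, 1)"
    and "\<And>i j. i \<in> {1..n+1} \<Longrightarrow> j \<in> {1..n+1} \<Longrightarrow> i \<noteq> j \<Longrightarrow> 0 < gram_cofactor n \<theta> i j"
proof -
  let ?I = "{1..n+1}"
  have I: "simplex_indices TYPE('n) = ?I" by (simp add: simplex_indices_def n)
  have angles: "\<exists>a b. outward_unit_normal v P i a \<and> outward_unit_normal v P j b \<and> a \<star> b = - cos (\<theta> i j)"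
    if "i \<in> ?I" "j \<in> ?I" "i \<noteq> j" for i j
  proof -
    have "has_dihedral_angle v P i j (\<theta> i j)" by (rule dihedral[OF that])
    then show ?thesis unfolding has_dihedral_angle_def by (elim conjE)
  qed
  have ex: "\<exists>u. outward_unit_normal v P i u" if "i \<in> ?I" for i
  proof -
    define j :: nat where "j = (if i = 1 then 2 else 1)"
    have "j \<in> ?I" "i \<noteq> j" using n n2 by (auto simp: j_def)
    then show ?thesis using angles[OF that] by metis
  qed
  then obtain u where u: "\<And>i. i \<in> ?I \<Longrightarrow> outward_unit_normal v P i (u i)" by metis
  have gram: "u i \<star> u j = - cos (\<theta> i j)" if ij: "i \<in> ?I" "j \<in> ?I" for i j
  proof (cases "i = j")
    case True
    then have "\<theta> i j = pi" using pi_iff[OF ij] by simp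
    then show ?thesis using True u[OF ij(1)] by (simp add: outward_unit_normal_def)
  next
    case False
    then obtain a b where "outward_unit_normal v P i a" "outward_unit_normal v P j b"
      "a \<star> b = - cos (\<theta> i j)" using angles[OF ij] by metis
    then show ?thesis using outward_unit_normal_unique[OF gs n2] u ij I by metis
  qed
  have off: "u i \<star> v j = 0" if "i \<in> ?I" "j \<in> ?I" "i \<noteq> j" for i j
    using outward_unit_normal_vertices(1)[OF gs n2 _ u] I that by metis
  have diag: "u i \<star> v i < 0" if "i \<in> ?I" for i
    using outward_unit_normal_vertices(2)[OF gs n2 _ u] I that by metis
  then have diag0: "u i \<star> v i \<noteq> 0" if "i \<in> ?I" for i using that by force
  have det: "Determinant.det (gram_matrix n \<theta>) \<noteq> 0"
    using gram_cofactor_eq(1)[of n u \<theta> v] n gram off diag0 by blast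
  have cof: "gram_cofactor n \<theta> i j =
      Determinant.det (gram_matrix n \<theta>) * ((v i \<star> v j) / ((u i \<star> v i) * (u j \<star> v j)))"
    if "i \<in> ?I" "j \<in> ?I" for i j
    using gram_cofactor_eq(2)[of n u \<theta> v i j] n gram off diag0 that by blast
  have sig: "matrix_signature (gram_matrix n \<theta>) = (n, 1)" "Determinant.det (gram_matrix n \<theta>) < 0"
    using gram_signature[of n u \<theta>] n gram det by blast+
  have "0 < gram_cofactor n \<theta> i j" if ij: "i \<in> ?I" "j \<in> ?I" "i \<noteq> j" for i j
  proof -
    have "v i \<star> v j < 0" using generalized_simplex_properties(3)[OF gs n2] ij I by metis
    then show ?thesis unfolding cof[OF ij(1,2)] using sig(2) diag[OF ij(1)] diag[OF ij(2)]
      by (intro mult_neg_neg divide_neg_pos mult_neg_neg) auto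
  qed
  then show "\<And>i j. i \<in> ?I \<Longrightarrow> j \<in> ?I \<Longrightarrow> i \<noteq> j \<Longrightarrow> 0 < gram_cofactor n \<theta> i j" by blast
  show "matrix_signature (gram_matrix n \<theta>) = (n, 1)" by (rule sig(1))
qed

section \<open>Construction of truncated simplices\<close>

text \<open>
  The polar hyperplane of \<open>w = v i\<close> separates \<open>w\<close> from all other vertices, so it meets each edge from
  \<open>w\<close> to \<open>v j\<close> in an interior point \<open>p j\<close>. These points span the base, and the part of the simplex on
  the side of \<open>w\<close> is the simplex spanned by \<open>w\<close> and the \<open>p j\<close>.
\<close>

lemma truncatable_at_vertex:
  fixes u v :: "nat \<Rightarrow> 'n::finite lorentz"
  defines "I \<equiv> simplex_indices TYPE('n)"
  assumes plane: "vertex_set v \<subseteq> proj_plane"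
    and off: "\<And>k l. k \<in> I \<Longrightarrow> l \<in> I \<Longrightarrow> k \<noteq> l \<Longrightarrow> u k \<star> v l = 0"
    and diag: "\<And>k. k \<in> I \<Longrightarrow> u k \<star> v k \<noteq> 0"
    and i: "i \<in> I" and ext: "0 < v i \<star> v i"
    and neg: "\<And>j. j \<in> I \<Longrightarrow> j \<noteq> i \<Longrightarrow> v j \<star> v i < 0"
  shows "truncatable_at v (v i)"
proof -
  define w where "w = v i"
  define S where "S = spanned_simplex v"
  have fin: "finite I" by (simp add: I_def)
  have S: "S = convex hull (v ` I)" by (simp add: S_def spanned_simplex_def vertex_set_def I_def)
  have Splane: "S \<subseteq> proj_plane" using spanned_simplex_subset_proj_plane[OF plane] by (simp add: S_def)
  \<comment> \<open>The parameter of the edge from \<open>w\<close> to \<open>v j\<close> at which \<open>\<lambda>x. x \<star> w\<close>, affine along the edge and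
      of opposite signs at its ends, vanishes.\<close>
  define t where "t j = w \<star> w / (w \<star> w - v j \<star> w)" for j
  define p where "p j = (1 - t j) *\<^sub>R w + t j *\<^sub>R v j" for j
  have t: "0 < t j" "t j < 1" if "j \<in> I" "j \<noteq> i" for j
    using ext neg[OF that] by (simp_all add: t_def w_def field_simps)
  have pw: "p j \<star> w = 0" if "j \<in> I" "j \<noteq> i" for j
  proof -
    have "w \<star> w - v j \<star> w \<noteq> 0" using ext neg[OF that] by (simp add: w_def)
    then show ?thesis by (simp add: p_def lorentz_simps t_def field_simps)
  qed
  have pS: "p j \<in> S" if "j \<in> I" "j \<noteq> i" for j
    using t[OF that] that i unfolding p_def S w_def
    by (intro convexD[OF convex_convex_hull]) (auto intro: hull_inc)
  have wS: "w \<in> S" using i by (auto simp: S w_def intro: hull_inc)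
  define B where "B = truncation_base v w"
  have B: "B = {x \<in> S. x \<star> w = 0}"
    using Splane ext by (auto simp: B_def truncation_base_def polar_hyperplane_def S_def w_def unit_multiple_sign)
  have pB: "p j \<in> B" if "j \<in> I" "j \<noteq> i" for j using pS pw that by (simp add: B)
  \<comment> \<open>Barycentric coordinates with respect to \<open>w\<close> and the \<open>p j\<close>. As the \<open>p j\<close> are orthogonal to \<open>w\<close>,
      the weight of \<open>w\<close> is \<open>x \<star> w / (w \<star> w)\<close>: it is nonnegative on the side of \<open>w\<close> and zero on the
      polar hyperplane.\<close>
  have decomp: "\<exists>m. (\<forall>j\<in>I - {i}. 0 \<le> m j) \<and> 0 \<le> l \<and> l + sum m (I - {i}) = 1 \<and>
      x = l *\<^sub>R w + (\<Sum>j\<in>I - {i}. m j *\<^sub>R p j)"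
    if x: "x \<in> S" "0 \<le> x \<star> w" and l: "l = x \<star> w / (w \<star> w)" for x l
  proof -
    obtain a where a: "\<forall>k\<in>I. 0 \<le> a k" "sum a I = 1" "x = (\<Sum>k\<in>I. a k *\<^sub>R v k)"
      using x(1) unfolding S convex_hull_finite_image[OF fin] by auto
    define m where "m j = a j / t j" for j
    define l' where "l' = a i - (\<Sum>j\<in>I - {i}. m j * (1 - t j))"
    have mt: "a j = m j * t j" if "j \<in> I - {i}" for j using t that by (simp add: m_def less_imp_neq[symmetric])
    have "x = a i *\<^sub>R w + (\<Sum>j\<in>I - {i}. a j *\<^sub>R v j)"
      using fin i by (simp add: a(3) sum.remove[of I i] w_def)
    also have "(\<Sum>j\<in>I - {i}. a j *\<^sub>R v j) = (\<Sum>j\<in>I - {i}. m j *\<^sub>R p j - (m j * (1 - t j)) *\<^sub>R w)"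
      by (intro sum.cong refl) (simp add: mt p_def scaleR_add_right)
    also have "a i *\<^sub>R w + \<dots> = l' *\<^sub>R w + (\<Sum>j\<in>I - {i}. m j *\<^sub>R p j)"
      by (simp add: l'_def sum_subtractf scaleR_diff_left flip: scaleR_sum_left)
    finally have x_eq: "x = l' *\<^sub>R w + (\<Sum>j\<in>I - {i}. m j *\<^sub>R p j)" .
    have "(\<Sum>j\<in>I - {i}. m j *\<^sub>R p j) \<star> w = 0"
      using pw by (simp add: lorentz.sum_left lorentz_simps)
    then have "x \<star> w = l' * (w \<star> w)" by (simp add: x_eq lorentz_simps)
    then have "l = l'" using ext by (simp add: l w_def)
    moreover have "0 \<le> l" using x ext by (simp add: l w_def)
    moreover have "l' + sum m (I - {i}) = a i + (\<Sum>j\<in>I - {i}. m j * t j)"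
      by (simp add: l'_def right_diff_distrib sum_subtractf)
    moreover have "a i + (\<Sum>j\<in>I - {i}. m j * t j) = sum a I"
      using fin i mt by (simp add: sum.remove[of I i])
    moreover have "\<forall>j\<in>I - {i}. 0 \<le> m j" using a t by (simp add: m_def less_imp_le)
    ultimately show ?thesis using x_eq a(2) by (intro exI[of _ m]) auto
  qed
  have base: "B = convex hull (p ` (I - {i}))"
  proof
    show "B \<subseteq> convex hull (p ` (I - {i}))"
    proof
      fix x assume "x \<in> B"
      then have "x \<in> S" "x \<star> w = 0" by (simp_all add: B)
      with decomp[of x 0] obtain m where m: "\<forall>j\<in>I - {i}. 0 \<le> m j" "sum m (I - {i}) = 1"
        "x = (\<Sum>j\<in>I - {i}. m j *\<^sub>R p j)" by auto
      have "finite (I - {i})" using fin by simp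
      then show "x \<in> convex hull (p ` (I - {i}))" unfolding convex_hull_finite_image[OF \<open>finite (I - {i})\<close>] using m by blast
    qed
    have "convex B" unfolding B S
      by (intro convexI) (auto simp: lorentz_simps intro: convexD[OF convex_convex_hull])
    then show "convex hull (p ` (I - {i})) \<subseteq> B" using pB by (intro hull_minimal image_subsetI) auto
  qed
  have pyr: "truncation_pyramid v w = {x \<in> S. 0 \<le> x \<star> w}"
  proof
    have "convex {x \<in> S. 0 \<le> x \<star> w}" unfolding S
      by (intro convexI) (auto simp: lorentz_simps intro: convexD[OF convex_convex_hull])
    then show "truncation_pyramid v w \<subseteq> {x \<in> S. 0 \<le> x \<star> w}"
      using wS ext unfolding truncation_pyramid_def B_def[symmetric]
      by (intro hull_minimal) (auto simp: B w_def less_imp_le)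
    show "{x \<in> S. 0 \<le> x \<star> w} \<subseteq> truncation_pyramid v w"
    proof
      fix x assume "x \<in> {x \<in> S. 0 \<le> x \<star> w}"
      then obtain m l where m: "\<forall>j\<in>I - {i}. 0 \<le> m j" "0 \<le> l" "l + sum m (I - {i}) = 1"
        "x = l *\<^sub>R w + (\<Sum>j\<in>I - {i}. m j *\<^sub>R p j)" using decomp[of x, OF _ _ refl] by auto
      define m' where "m' = m(i := l)"
      define p' where "p' = p(i := w)"
      have "x = (\<Sum>j\<in>I. m' j *\<^sub>R p' j)"
        using fin i unfolding m(4) by (simp add: sum.remove[of I i] m'_def p'_def)
      moreover have "sum m' I = 1" using m(3) fin i by (simp add: sum.remove[of I i] m'_def)
      moreover have "p' j \<in> insert w B" if "j \<in> I" for j using pB that by (simp add: p'_def)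
      then have "p' j \<in> convex hull (insert w B)" if "j \<in> I" for j using that by (blast intro: hull_inc)
      moreover have "0 \<le> m' j" if "j \<in> I" for j using m that by (simp add: m'_def)
      ultimately show "x \<in> truncation_pyramid v w"
        using fin unfolding truncation_pyramid_def B_def[symmetric]
        by (simp add: convex_sum[OF _ convex_convex_hull])
    qed
  qed
  have "u k \<star> p l = (if k = l then t l * (u l \<star> v l) else 0)" if "k \<in> I - {i}" "l \<in> I - {i}" for k l
    using off i that by (auto simp: p_def w_def lorentz_simps)
  then have dual: "inj_on p (I - {i})" "independent (p ` (I - {i}))"
    using dual_family_independent[of "I - {i}" u p] fin diag t by (auto simp: less_imp_neq[symmetric])
  have "(int CARD('n) - 1) simplex B"
    unfolding base using dual fin i
    by (intro simplex_convex_hull conjI)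
       (use affine_dependent_imp_dependent in \<open>auto simp: card_image I_def\<close>)
  moreover have "truncation_pyramid v w \<inter> vertex_set v = {w}"
  proof -
    have "s = w" if "s \<in> truncation_pyramid v w" "s \<in> vertex_set v" for s
    proof -
      obtain k where k: "k \<in> I" "s = v k" using \<open>s \<in> vertex_set v\<close> unfolding vertex_set_def I_def by blast
      have "0 \<le> v k \<star> v i" using that(1) unfolding pyr by (simp add: k(2) w_def)
      then have "k = i" using neg[OF k(1)] by (meson not_le)
      then show ?thesis using k by (simp add: w_def)
    qed
    moreover have "w \<in> truncation_pyramid v w" unfolding pyr using wS ext by (simp add: w_def)
    moreover have "w \<in> vertex_set v" using i by (simp add: vertex_set_def w_def I_def)
    ultimately show ?thesis by blast
  qed
  moreover have "truncation_pyramid v w = {x \<in> spanned_simplex v. 0 \<le> x \<star> unit_multiple w}"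
    using pyr ext by (simp add: S_def w_def unit_multiple_sign)
  ultimately show ?thesis by (simp add: truncatable_at_def B_def w_def)
qed

text \<open>
  The plane spanned by \<open>a\<close> and \<open>b\<close> is positive semidefinite. If it is degenerate, its null vector \<open>a + b\<close>
  is orthogonal to the whole plane; otherwise subtract from a timelike vector its orthogonal projection
  to the plane, whose square is nonnegative. For facet normals the degenerate case is the dihedral
  angle \<open>0\<close>.
\<close>

lemma exists_nonpositive_orthogonal:
  fixes a b :: "'n::finite lorentz"
  assumes a: "a \<star> a = 1" and b: "b \<star> b = 1" and c: "-1 \<le> a \<star> b" "a \<star> b < 1" and ne: "a \<noteq> - b"
  obtains y where "y \<noteq> 0" "y \<star> a = 0" "y \<star> b = 0" "y \<star> y \<le> 0"
proof (cases "a \<star> b = -1")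
  case True
  then show thesis using that[of "a + b"] a b ne lorentz_commute[of b a]
    by (simp add: lorentz_simps eq_neg_iff_add_eq_0)
next
  case False
  define c where "c = a \<star> b"
  have ba: "b \<star> a = c" by (simp add: c_def lorentz_commute)
  let ?e = "proj_origin :: 'n lorentz"
  define p where "p = ?e \<star> a"
  define q where "q = ?e \<star> b"
  define D where "D = 1 - c\<^sup>2"
  have "-1 < c" "c < 1" using assms(3,4) False unfolding c_def by linarith+
  then have "0 < (1 - c) * (1 + c)" by simp
  also have "\<dots> = D" by (simp add: D_def power2_eq_square algebra_simps)
  finally have D: "0 < D" .
  define s where "s = (p - c * q) / D"
  define t where "t = (q - c * p) / D"
  define y where "y = ?e - s *\<^sub>R a - t *\<^sub>R b"
  have sD: "s * D = p - c * q" and tD: "t * D = q - c * p"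
    using D by (simp_all add: s_def t_def)
  have "(s + t * c) * D = s * D + t * D * c" "(s * c + t) * D = s * D * c + t * D"
    by (simp_all add: algebra_simps)
  then have "(s + t * c) * D = p * D" "(s * c + t) * D = q * D"
    by (simp_all add: sD tD) (simp_all add: D_def power2_eq_square algebra_simps)
  then have "s + t * c = p" "s * c + t = q" using D by auto
  then have ya: "y \<star> a = 0" and yb: "y \<star> b = 0"
    using a b ba by (simp_all add: y_def lorentz.diff_left lorentz.scaleR_left del: lorentz_proj_origin flip: p_def q_def c_def)
  have "y \<star> y = y \<star> ?e - s * (y \<star> a) - t * (y \<star> b)"
    by (subst (2) y_def) (simp only: lorentz.diff_right lorentz.scaleR_right real_scaleR_def)
  also have "\<dots> = ?e \<star> y" using ya yb by (simp add: lorentz_commute[of y ?e] del: lorentz_proj_origin)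
  also have "\<dots> = ?e \<star> ?e - s * p - t * q"
    by (simp only: y_def lorentz.diff_right lorentz.scaleR_right real_scaleR_def p_def q_def)
  also have "?e \<star> ?e = -1" by (simp add: lorentz_inner_def proj_origin_def)
  finally have yy: "y \<star> y = -1 - s * p - t * q" .
  have "(s * p + t * q) * D = s * D * p + t * D * q" by (simp add: algebra_simps)
  also have "\<dots> = (p - c * q)\<^sup>2 + D * q\<^sup>2"
    unfolding sD tD by (simp add: D_def power2_eq_square algebra_simps)
  finally have "0 \<le> (s * p + t * q) * D" using D by simp
  then have "0 \<le> s * p + t * q" using D by (simp add: zero_le_mult_iff)
  then have "y \<star> y < 0" using yy by simp
  then have "y \<noteq> 0" by (auto simp: lorentz.zero_left)
  then show thesis using that ya yb \<open>y \<star> y < 0\<close> by simp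
qed

text \<open>
  Conversely to \<open>generalized_simplex_properties\<close>, negative products of the vertices and dihedral
  angles in \<open>[0, \<pi>)\<close> turn a simplex that contains the origin into a truncated simplex. Truncation is then possible by
  \<open>truncatable_at_vertex\<close>. The span of the ridge opposite to \<open>v i\<close> and \<open>v j\<close> is the orthogonal
  complement of \<open>u i\<close> and \<open>u j\<close>, which is why a vector of this complement has coefficients only on the
  vertices of the ridge.
\<close>

lemma polar_truncated_simplex_of_dual:
  fixes u v :: "nat \<Rightarrow> 'n::finite lorentz"
  defines "I \<equiv> simplex_indices TYPE('n)"
  assumes plane: "vertex_set v \<subseteq> proj_plane"
    and off: "\<And>k l. k \<in> I \<Longrightarrow> l \<in> I \<Longrightarrow> k \<noteq> l \<Longrightarrow> u k \<star> v l = 0"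
    and diag: "\<And>k. k \<in> I \<Longrightarrow> u k \<star> v k < 0"
    and neg: "\<And>k l. k \<in> I \<Longrightarrow> l \<in> I \<Longrightarrow> k \<noteq> l \<Longrightarrow> v k \<star> v l < 0"
    and origin: "proj_origin \<in> spanned_simplex v"
    and unit: "\<And>k. k \<in> I \<Longrightarrow> u k \<star> u k = 1"
    and angle: "\<And>k l. k \<in> I \<Longrightarrow> l \<in> I \<Longrightarrow> k \<noteq> l \<Longrightarrow> -1 \<le> u k \<star> u l \<and> u k \<star> u l < 1"
  shows "polar_truncated_simplex v (truncated_simplex v)"
    and "\<And>i. i \<in> I \<Longrightarrow> outward_unit_normal v (truncated_simplex v) i (u i)"
proof -
  have fin: "finite I" and card: "card I = CARD('n) + 1" by (simp_all add: I_def)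
  have diag0: "u k \<star> v k \<noteq> 0" if "k \<in> I" for k using diag[OF that] by simp
  have V: "vertex_set v = v ` I" by (simp add: vertex_set_def I_def)
  note dual = dual_family_independent[of I u v, OF fin off diag0]
  have indep: "\<not> affine_dependent (v ` I)"
    using dual(2) affine_dependent_imp_dependent by auto
  have sv: "simplex_vertices v"
    using plane dual(1) indep by (simp add: simplex_vertices_def V I_def)
  have tr: "truncatable_at v w" if w: "w \<in> vertex_set v \<inter> klein_exterior" for w
  proof -
    obtain i where i: "i \<in> I" "w = v i" using w V by auto
    have "0 < v i \<star> v i" using w i plane klein_iff(3) by blast
    then show ?thesis
      unfolding i(2) using plane off diag0 i(1) neg
      by (intro truncatable_at_vertex[where u = u]) (auto simp: I_def)
  qed
  have ridge: "rel_interior (ridge_opposite v i j) \<inter> (klein_ball \<union> klein_sphere) \<noteq> {}"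
    if ij: "i \<in> I" "j \<in> I" "i \<noteq> j" for i j
  proof -
    let ?K = "I - {i, j}"
    have "u i \<noteq> - u j"
    proof
      assume "u i = - u j"
      then have "u i \<star> v i = 0" using off[of j i] ij by (simp add: lorentz.minus_left)
      then show False using diag0 ij by simp
    qed
    then obtain y where y: "y \<noteq> 0" "y \<star> u i = 0" "y \<star> u j = 0" "y \<star> y \<le> 0"
      using exists_nonpositive_orthogonal[of "u i" "u j"] unit angle[OF ij] ij by metis
    define b where "b k = (u k \<star> y) / (u k \<star> v k)" for k
    have "y = (\<Sum>k\<in>I. b k *\<^sub>R v k)"
      unfolding b_def by (rule dual_family_expansion[of I u v, OF card off diag0])
    also have "\<dots> = (\<Sum>k\<in>?K. b k *\<^sub>R v k)"
      using fin y(2,3) by (intro sum.mono_neutral_right) (auto simp: b_def lorentz_commute)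
    finally have yb: "y = (\<Sum>k\<in>?K. b k *\<^sub>R v k)" .
    have bne: "\<exists>k\<in>?K. b k \<noteq> 0"
    proof (rule ccontr)
      assume "\<not> (\<exists>k\<in>?K. b k \<noteq> 0)"
      then have "y = 0" unfolding yb by (intro sum.neutral) simp
      then show False using y by simp
    qed
    have finK: "finite ?K" using fin by simp
    have negK: "v k \<star> v l < 0" if "k \<in> ?K" "l \<in> ?K" "k \<noteq> l" for k l using neg that by auto
    have bK: "(\<Sum>k\<in>?K. b k *\<^sub>R v k) \<star> (\<Sum>k\<in>?K. b k *\<^sub>R v k) \<le> 0" using y(4) unfolding yb .
    obtain a where a: "\<And>k. k \<in> ?K \<Longrightarrow> 0 < a k" "sum a ?K = 1"
      "(\<Sum>k\<in>?K. a k *\<^sub>R v k) \<star> (\<Sum>k\<in>?K. a k *\<^sub>R v k) \<le> 0"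
      using exists_positive_combination[of ?K v b, OF finK negK bne bK] by blast
    define x where "x = (\<Sum>k\<in>?K. a k *\<^sub>R v k)"
    have injK: "inj_on v ?K" using dual(1) by (rule inj_on_subset) auto
    have indK: "\<not> affine_dependent (v ` ?K)"
      using indep affine_dependent_subset[of "v ` ?K" "v ` I"] by auto
    define g where "g = the_inv_into ?K v"
    have g: "g (v k) = k" if "k \<in> ?K" for k using the_inv_into_f_f[OF injK that] by (simp add: g_def)
    have "\<forall>z\<in>v ` ?K. 0 < a (g z)" using a(1) g by simp
    moreover have "(\<Sum>z\<in>v ` ?K. a (g z)) = 1"
      using a(2) g by (simp add: sum.reindex[OF injK])
    moreover have "(\<Sum>z\<in>v ` ?K. a (g z) *\<^sub>R z) = x"
      using g by (simp add: sum.reindex[OF injK] x_def)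
    ultimately have "x \<in> rel_interior (ridge_opposite v i j)"
      unfolding ridge_opposite_def I_def[symmetric] rel_interior_convex_hull_explicit[OF indK]
      by (intro CollectI exI[of _ "\<lambda>z. a (g z)"] conjI)
    moreover have "ridge_opposite v i j \<subseteq> proj_plane"
      unfolding ridge_opposite_def using plane V
      by (intro hull_minimal convex_proj_plane) (auto simp: I_def)
    ultimately have "x \<in> rel_interior (ridge_opposite v i j)" "x \<in> proj_plane"
      using rel_interior_subset by blast+
    then show ?thesis using klein_iff[of x] a(3) x_def by (auto simp: less_le)
  qed
  show pts: "polar_truncated_simplex v (truncated_simplex v)"
    unfolding polar_truncated_simplex_def ridges_meet_closed_ball_def
    using sv origin ridge tr by (auto simp: I_def)
  fix i assume i: "i \<in> I"
  have PS: "truncated_simplex v \<subseteq> spanned_simplex v" by (auto simp: truncated_simplex_def)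
  have zero: "u i \<star> x = 0" if "x \<in> facet_opposite v i" for x
  proof -
    have "s \<star> u i = 0" if "s \<in> v ` (I - {i})" for s
    proof -
      obtain k where "k \<in> I" "k \<noteq> i" "s = v k" using \<open>s \<in> v ` (I - {i})\<close> by blast
      then show ?thesis using off[OF i, of k] by (simp add: lorentz_commute[of "v k"])
    qed
    moreover have "x \<in> convex hull (v ` (I - {i}))" using that by (simp add: facet_opposite_def I_def)
    ultimately have "x \<star> u i = 0" by (rule lorentz_hull_eq_0)
    then show ?thesis by (simp add: lorentz_commute[of "u i" x])
  qed
  have nonpos: "u i \<star> x \<le> 0" if "x \<in> spanned_simplex v" for x
  proof -
    have "s \<star> u i \<le> 0" if "s \<in> v ` I" for s
    proof -
      obtain k where k: "k \<in> I" "s = v k" using \<open>s \<in> v ` I\<close> by blast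
      then show ?thesis
        using off[OF i, of k] diag[OF i] by (cases "k = i") (simp_all add: lorentz_commute[of "v _" "u i"])
    qed
    moreover have "x \<in> convex hull (v ` I)" using that by (simp add: spanned_simplex_def V)
    ultimately have "x \<star> u i \<le> 0" by (rule lorentz_hull_le)
    then show ?thesis by (simp add: lorentz_commute[of "u i" x])
  qed
  show "outward_unit_normal v (truncated_simplex v) i (u i)"
    unfolding outward_unit_normal_def polyhedron_facet_def
  proof (intro conjI ballI)
    show "u i \<star> x = 0" if "x \<in> truncated_simplex v \<inter> facet_opposite v i" for x
      using that by (intro zero) simp
    show "u i \<star> x \<le> 0" if "x \<in> truncated_simplex v" for x using that PS by (intro nonpos) auto
  qed (rule unit[OF i])
qed

text \<open>
  The family \<open>w\<close> has to be moved by an isometry into the half space of positive first coordinate, so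
  that it can be scaled into the chart. For this one needs a timelike vector that is a nonnegative
  combination of the \<open>w k\<close> and has negative product with each of them; the isometry taking it to the
  direction of the origin of the chart then also puts the origin into the simplex.
\<close>

lemma exists_normalized_dual:
  fixes u w :: "nat \<Rightarrow> 'n::finite lorentz"
  defines "I \<equiv> simplex_indices TYPE('n)"
  assumes off: "\<And>k l. k \<in> I \<Longrightarrow> l \<in> I \<Longrightarrow> k \<noteq> l \<Longrightarrow> u k \<star> w l = 0"
    and diag: "\<And>k. k \<in> I \<Longrightarrow> u k \<star> w k < 0"
    and neg: "\<And>k l. k \<in> I \<Longrightarrow> l \<in> I \<Longrightarrow> k \<noteq> l \<Longrightarrow> w k \<star> w l < 0"
  obtains u' v :: "nat \<Rightarrow> 'n lorentz" where
    "\<And>k l. u' k \<star> u' l = u k \<star> u l"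
    "\<And>k l. k \<in> I \<Longrightarrow> l \<in> I \<Longrightarrow> k \<noteq> l \<Longrightarrow> u' k \<star> v l = 0"
    "\<And>k. k \<in> I \<Longrightarrow> u' k \<star> v k < 0"
    "\<And>k l. k \<in> I \<Longrightarrow> l \<in> I \<Longrightarrow> k \<noteq> l \<Longrightarrow> v k \<star> v l < 0"
    "vertex_set v \<subseteq> proj_plane" "proj_origin \<in> spanned_simplex v"
proof -
  have fin: "finite I" and card: "card I = CARD('n) + 1" by (simp_all add: I_def)
  have diag0: "u k \<star> w k \<noteq> 0" if "k \<in> I" for k using diag[OF that] by simp
  let ?e = "proj_origin :: 'n lorentz"
  have ee: "?e \<star> ?e = -1" by (simp add: lorentz_inner_def proj_origin_def)
  \<comment> \<open>Any timelike vector yields a timelike point of the hull of the \<open>w k\<close>, on taking absolute values of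
      its coefficients.\<close>
  define b where "b k = (u k \<star> ?e) / (u k \<star> w k)" for k
  have e: "?e = (\<Sum>k\<in>I. b k *\<^sub>R w k)"
    unfolding b_def by (rule dual_family_expansion[of I u w, OF card off diag0])
  have "\<exists>k\<in>I. b k \<noteq> 0"
  proof (rule ccontr)
    assume "\<not> (\<exists>k\<in>I. b k \<noteq> 0)"
    then have "?e = 0" unfolding e by (intro sum.neutral) simp
    then show False using ee by (simp add: lorentz.zero_left)
  qed
  define s where "s = (\<Sum>k\<in>I. \<bar>b k\<bar>)"
  have s: "0 < s" using \<open>\<exists>k\<in>I. b k \<noteq> 0\<close> fin unfolding s_def by (auto intro: sum_pos2)
  define y where "y = (\<Sum>k\<in>I. (\<bar>b k\<bar> / s) *\<^sub>R w k)"
  have y: "y \<in> convex hull (w ` I)"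
    unfolding convex_hull_finite_image[OF fin] y_def using s
    by (auto intro!: exI[of _ "\<lambda>k. \<bar>b k\<bar> / s"] simp: s_def simp flip: sum_divide_distrib)
  have "y = (1 / s) *\<^sub>R (\<Sum>k\<in>I. \<bar>b k\<bar> *\<^sub>R w k)" by (simp add: y_def scaleR_sum_right)
  moreover have "(\<Sum>k\<in>I. \<bar>b k\<bar> *\<^sub>R w k) \<star> (\<Sum>k\<in>I. \<bar>b k\<bar> *\<^sub>R w k) \<le> ?e \<star> ?e"
    unfolding e by (rule abs_coeffs_lorentz_le) (use neg in \<open>auto simp: less_imp_le\<close>)
  ultimately have "y \<star> y < 0"
    using s ee by (simp add: lorentz.scaleR_left lorentz.scaleR_right divide_less_0_iff)
  from exists_hull_point_negative_on_vertices[OF fin neg y this]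
  obtain x where x: "x \<in> convex hull (w ` I)" "\<And>k. k \<in> I \<Longrightarrow> x \<star> w k < 0" by auto
  have xx: "x \<star> x < 0"
    by (rule lorentz_hull_less[OF _ x(1)]) (use x(2) in \<open>auto simp: lorentz_commute\<close>)
  obtain R :: "'n lorentz \<Rightarrow> 'n lorentz" where R: "linear R" "\<And>y z. R y \<star> R z = y \<star> z"
    "R x = sqrt (- (x \<star> x)) *\<^sub>R ?e"
    using exists_lorentz_isometry[OF xx] by blast
  define r where "r = sqrt (- (x \<star> x))"
  have r: "0 < r" using xx by (simp add: r_def)
  define h where "h k = fst (R (w k))" for k
  have h: "0 < h k" if "k \<in> I" for k
  proof -
    have "r * h k = - (R x \<star> R (w k))" by (simp add: R(3) r_def h_def lorentz.scaleR_left)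
    also have "\<dots> > 0" using x(2)[OF that] by (simp add: R(2))
    finally show ?thesis using r by (simp add: zero_less_mult_iff)
  qed
  define v where "v k = (1 / h k) *\<^sub>R R (w k)" for k
  have fst_v: "fst (v k) = 1" if "k \<in> I" for k using h[OF that] by (simp add: v_def flip: h_def)
  then have vplane: "vertex_set v \<subseteq> proj_plane"
    unfolding vertex_set_def I_def[symmetric] by (intro image_subsetI) (simp add: proj_plane_def)
  obtain a where a: "\<forall>k\<in>I. 0 \<le> a k" "x = (\<Sum>k\<in>I. a k *\<^sub>R w k)"
    using x(1) unfolding convex_hull_finite_image[OF fin] by auto
  define c where "c k = a k * h k / r" for k
  have "?e = (1 / r) *\<^sub>R R x" using r by (simp add: R(3) r_def)
  also have "\<dots> = (\<Sum>k\<in>I. (a k / r) *\<^sub>R R (w k))"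
    using R(1) by (simp add: a(2) linear_sum linear_scale scaleR_sum_right)
  also have "\<dots> = (\<Sum>k\<in>I. c k *\<^sub>R v k)"
  proof (intro sum.cong refl)
    fix k assume "k \<in> I"
    then show "(a k / r) *\<^sub>R R (w k) = c k *\<^sub>R v k" using h[of k] by (simp add: c_def v_def)
  qed
  finally have ec: "?e = (\<Sum>k\<in>I. c k *\<^sub>R v k)" .
  have "1 = fst ?e" by (simp add: proj_origin_def)
  also have "\<dots> = (\<Sum>k\<in>I. c k * fst (v k))" by (subst ec) (simp add: fst_sum)
  also have "\<dots> = sum c I" using fst_v by simp
  finally have "sum c I = 1" by simp
  moreover have "\<forall>k\<in>I. 0 \<le> c k" using a h r by (auto simp: c_def less_imp_le)
  ultimately have origin: "?e \<in> spanned_simplex v"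
    unfolding spanned_simplex_def vertex_set_def I_def[symmetric] convex_hull_finite_image[OF fin]
    using ec by blast
  show thesis
  proof (rule that[of "R \<circ> u" v])
    show "(R \<circ> u) k \<star> v l = 0" if "k \<in> I" "l \<in> I" "k \<noteq> l" for k l
      using off that by (simp add: v_def R(2) lorentz.scaleR_right)
    show "(R \<circ> u) k \<star> v k < 0" if "k \<in> I" for k
      using diag[OF that] h[OF that] by (simp add: v_def R(2) lorentz.scaleR_right divide_less_0_iff)
    show "v k \<star> v l < 0" if "k \<in> I" "l \<in> I" "k \<noteq> l" for k l
      using neg[OF that] h that
      by (simp add: v_def R(2) lorentz.scaleR_right lorentz.scaleR_left divide_less_0_iff)
  qed (simp_all add: R(2) vplane origin)
qed

text \<open>
  The vectors realizing \<open>G\<close> become the normals. Positive cofactors say that their dual family has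
  negative mutual products, so that after normalization it is the family of vertices.
\<close>

lemma exists_generalized_simplex_of_gram_conditions:
  assumes n: "n = CARD('n)"
    and range: "\<And>i j. i \<in> {1..n+1} \<Longrightarrow> j \<in> {1..n+1} \<Longrightarrow> 0 \<le> \<theta> i j \<and> \<theta> i j \<le> pi"
    and sym: "\<And>i j. i \<in> {1..n+1} \<Longrightarrow> j \<in> {1..n+1} \<Longrightarrow> \<theta> i j = \<theta> j i"
    and pi_iff: "\<And>i j. i \<in> {1..n+1} \<Longrightarrow> j \<in> {1..n+1} \<Longrightarrow> \<theta> i j = pi \<longleftrightarrow> i = j"
    and sig: "matrix_signature (gram_matrix n \<theta>) = (n, 1)"
    and cof_pos: "\<And>i j. i \<in> {1..n+1} \<Longrightarrow> j \<in> {1..n+1} \<Longrightarrow> i \<noteq> j \<Longrightarrow> 0 < gram_cofactor n \<theta> i j"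
  obtains v :: "nat \<Rightarrow> 'n::finite lorentz" and P where "generalized_simplex v P"
    and "\<And>i j. i \<in> {1..n+1} \<Longrightarrow> j \<in> {1..n+1} \<Longrightarrow> i \<noteq> j \<Longrightarrow> has_dihedral_angle v P i j (\<theta> i j)"
proof -
  let ?I = "{1..n+1}"
  have I: "simplex_indices TYPE('n) = ?I" by (simp add: simplex_indices_def n)
  obtain u :: "nat \<Rightarrow> 'n lorentz" where gram: "\<And>i j. i \<in> ?I \<Longrightarrow> j \<in> ?I \<Longrightarrow> u i \<star> u j = - cos (\<theta> i j)"
    and det: "Determinant.det (gram_matrix n \<theta>) \<noteq> 0"
    using exists_gram_realization[OF n sym sig] by blast
  obtain w where off: "\<And>i j. i \<in> ?I \<Longrightarrow> j \<in> ?I \<Longrightarrow> i \<noteq> j \<Longrightarrow> u i \<star> w j = 0"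
    and diag: "\<And>i. i \<in> ?I \<Longrightarrow> u i \<star> w i = -1"
    using exists_dual_family[OF gram det] by blast
  then have diag0: "u i \<star> w i \<noteq> 0" if "i \<in> ?I" for i using that by force
  have cof: "gram_cofactor n \<theta> i j =
      Determinant.det (gram_matrix n \<theta>) * ((w i \<star> w j) / ((u i \<star> w i) * (u j \<star> w j)))"
    if "i \<in> ?I" "j \<in> ?I" for i j
    using gram_cofactor_eq(2)[of n u \<theta> w i j] n gram off diag0 that by blast
  have neg_det: "Determinant.det (gram_matrix n \<theta>) < 0"
    using gram_signature(2)[of n u \<theta>] n gram det by blast
  have neg: "w i \<star> w j < 0" if ij: "i \<in> ?I" "j \<in> ?I" "i \<noteq> j" for i j
  proof -
    have "0 < gram_cofactor n \<theta> i j" by (rule cof_pos[OF ij])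
    then show ?thesis
      unfolding cof[OF ij(1,2)] using neg_det diag ij by (simp add: zero_less_mult_iff)
  qed
  obtain u' v :: "nat \<Rightarrow> 'n lorentz" where uv:
    "\<And>k l. u' k \<star> u' l = u k \<star> u l"
    "\<And>k l. k \<in> ?I \<Longrightarrow> l \<in> ?I \<Longrightarrow> k \<noteq> l \<Longrightarrow> u' k \<star> v l = 0"
    "\<And>k. k \<in> ?I \<Longrightarrow> u' k \<star> v k < 0"
    "\<And>k l. k \<in> ?I \<Longrightarrow> l \<in> ?I \<Longrightarrow> k \<noteq> l \<Longrightarrow> v k \<star> v l < 0"
    "vertex_set v \<subseteq> proj_plane" "proj_origin \<in> spanned_simplex v"
  proof (rule exists_normalized_dual[of u w, unfolded I])
    show "u k \<star> w k < 0" if "k \<in> ?I" for k using diag[OF that] by simp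
  qed (use off neg in blast)+
  have u'u': "u' i \<star> u' j = - cos (\<theta> i j)" if "i \<in> ?I" "j \<in> ?I" for i j
    using uv(1) gram that by simp
  have unit: "u' i \<star> u' i = 1" if "i \<in> ?I" for i
    using u'u'[OF that that] pi_iff[OF that that] by simp
  have angle: "-1 \<le> u' i \<star> u' j \<and> u' i \<star> u' j < 1" if ij: "i \<in> ?I" "j \<in> ?I" "i \<noteq> j" for i j
  proof -
    have "0 \<le> \<theta> i j" "\<theta> i j < pi" using range[OF ij(1,2)] pi_iff[OF ij(1,2)] ij(3) by auto
    then have "cos pi < cos (\<theta> i j)" by (intro cos_monotone_0_pi) auto
    then show ?thesis using u'u'[OF ij(1,2)] by simp
  qed
  have "polar_truncated_simplex v (truncated_simplex v)"
    by (rule polar_truncated_simplex_of_dual(1)[of v u', unfolded I])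
       (rule uv(5,6) | (use uv(2-4) unit angle in blast))+
  then have gs: "generalized_simplex v (truncated_simplex v)" by (simp add: generalized_simplex_def)
  have normal: "outward_unit_normal v (truncated_simplex v) i (u' i)" if "i \<in> ?I" for i
    by (rule polar_truncated_simplex_of_dual(2)[of v u', unfolded I])
       (rule uv(5,6) that | (use uv(2-4) unit angle in blast))+
  have angles: "has_dihedral_angle v (truncated_simplex v) i j (\<theta> i j)"
    if ij: "i \<in> ?I" "j \<in> ?I" "i \<noteq> j" for i j
    unfolding has_dihedral_angle_def using normal[OF ij(1)] normal[OF ij(2)] u'u'[OF ij(1,2)] range[OF ij(1,2)]
    by (intro conjI exI[of _ "u' i"] exI[of _ "u' j"]) auto
  show thesis by (rule that[OF gs angles])
qed

section \<open>The characterization by dihedral angles\<close>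

theorem theorem3p2:
  fixes n :: nat and \<theta> :: "nat \<Rightarrow> nat \<Rightarrow> real"
  assumes "n = CARD('n::finite)"
    and "n \<ge> 3"
    and "\<And>i j. i \<in> {1..n+1} \<Longrightarrow> j \<in> {1..n+1} \<Longrightarrow> 0 \<le> \<theta> i j \<and> \<theta> i j \<le> pi"
    and "\<And>i j. i \<in> {1..n+1} \<Longrightarrow> j \<in> {1..n+1} \<Longrightarrow> \<theta> i j = \<theta> j i"
    and "\<And>i j. i \<in> {1..n+1} \<Longrightarrow> j \<in> {1..n+1} \<Longrightarrow> \<theta> i j = pi \<longleftrightarrow> i = j"
  shows "(\<exists>(v :: nat \<Rightarrow> 'n lorentz) P. generalized_simplex v P \<and>
            (\<forall>i \<in> {1..n+1}. \<forall>j \<in> {1..n+1}. i \<noteq> j \<longrightarrow> has_dihedral_angle v P i j (\<theta> i j)))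
     \<longleftrightarrow>
         (matrix_signature (gram_matrix n \<theta>) = (n, 1) \<and>
          (\<forall>i \<in> {1..n+1}. \<forall>j \<in> {1..n+1}. i \<noteq> j \<longrightarrow> gram_cofactor n \<theta> i j > 0))"
proof (intro iffI conjI)
  have n2: "CARD('n) \<ge> 2" using assms(1,2) by simp
  assume "\<exists>(v :: nat \<Rightarrow> 'n lorentz) P. generalized_simplex v P \<and>
      (\<forall>i \<in> {1..n+1}. \<forall>j \<in> {1..n+1}. i \<noteq> j \<longrightarrow> has_dihedral_angle v P i j (\<theta> i j))"
  then obtain v :: "nat \<Rightarrow> 'n lorentz" and P where vP: "generalized_simplex v P \<and>
      (\<forall>i \<in> {1..n+1}. \<forall>j \<in> {1..n+1}. i \<noteq> j \<longrightarrow> has_dihedral_angle v P i j (\<theta> i j))"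
    by (elim exE)
  note angles = conjunct2[OF vP, rule_format]
  note conditions = gram_conditions_of_generalized_simplex[OF assms(1) n2 conjunct1[OF vP] angles assms(5)]
  show "matrix_signature (gram_matrix n \<theta>) = (n, 1)"
    by (rule conditions(1))
  show "\<forall>i \<in> {1..n+1}. \<forall>j \<in> {1..n+1}. i \<noteq> j \<longrightarrow> gram_cofactor n \<theta> i j > 0"
    by (intro ballI impI) (rule conditions(2))
next
  assume conditions: "matrix_signature (gram_matrix n \<theta>) = (n, 1) \<and>
      (\<forall>i \<in> {1..n+1}. \<forall>j \<in> {1..n+1}. i \<noteq> j \<longrightarrow> gram_cofactor n \<theta> i j > 0)"
  obtain v :: "nat \<Rightarrow> 'n lorentz" and P where gs: "generalized_simplex v P"
    and angles: "\<And>i j. i \<in> {1..n+1} \<Longrightarrow> j \<in> {1..n+1} \<Longrightarrow> i \<noteq> j \<Longrightarrow> has_dihedral_angle v P i j (\<theta> i j)"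
    using exists_generalized_simplex_of_gram_conditions[where 'n = 'n, OF assms(1,3-5) conjunct1[OF conditions]
        conjunct2[OF conditions, rule_format]] by blast
  show "\<exists>(v :: nat \<Rightarrow> 'n lorentz) P. generalized_simplex v P \<and>
      (\<forall>i \<in> {1..n+1}. \<forall>j \<in> {1..n+1}. i \<noteq> j \<longrightarrow> has_dihedral_angle v P i j (\<theta> i j))"
    by (rule exI[of _ v], rule exI[of _ P]) (use gs angles in simp)
qed

end
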